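(* Let $f\in\mathbb{C}[x]$ be any polynomial of degree $d\ge 2$, let $g\in\mathbb{C}[x]$ be any nonconstant polynomial, and let $c\in\mathbb{C}^*$. Then there exist at most finitely many $\lambda\in\mathbb{C}$ such that both $g(\lambda)$ and $g(\lambda+c)$ are preperiodic for the polynomial $f(x)+\lambda$.
   Context: A point $z\in\mathbb{C}$ is preperiodic for a polynomial $h\in\mathbb{C}[x]$ if $h^i(z)=h^j(z)$ for some distinct nonnegative integers $i,j$, where $h^n$ denotes the $n$-th iterate under composition. *)

theory Defs
  imports Complex_Main "HOL-Computational_Algebra.Polynomial"
begin

definition preperiodic :: "complex poly \<Rightarrow> complex \<Rightarrow> bool" where
  "preperiodic h z \<longleftrightarrow> (\<exists>i j. i \<noteq> j \<and> (poly h ^^ i) z = (poly h ^^ j) z)"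

end

theory Submission
  imports Defs "Jordan_Normal_Form.Determinant"
begin

text \<open>Write \<open>P\<^sub>n(\<lambda>)\<close> and \<open>Q\<^sub>n(\<lambda>)\<close> for the \<open>n\<close>-th iterates of the two starting points under
  \<open>f + \<lambda>\<close>, with \<open>f\<close> monic of degree \<open>d\<close> after a conjugation. At a parameter where both points are
  preperiodic, all \<open>P\<^sub>n(\<lambda>)\<close> and \<open>Q\<^sub>n(\<lambda>)\<close> are bounded, uniformly in \<open>n\<close>, at every place. Their
  leading coefficients agree, but that of \<open>P\<^sub>n - Q\<^sub>n\<close> contains the factor \<open>d ^ n\<close>, because
  \<open>x ^ d - y ^ d\<close> is \<open>x - y\<close> times \<open>d\<close> monomials. So, up to a factor whose contributions at the
  different places cancel, \<open>(P\<^sub>n - Q\<^sub>n) / d ^ n\<close> is a monic polynomial which is tiny at the bad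
  parameters at the archimedean places: their capacity is less than 1, and Fekete's argument with
  Vandermonde determinants bounds their number. To treat arbitrary complex coefficients, the
  archimedean places are replaced by a submultiplicative cost on a finitely generated ring, obtained
  by Noether normalization from the sum of the absolute values of the coefficients of a polynomial.\<close>

section \<open>Rings with an archimedean cost\<close>

text \<open>The determinant lives in a ring generated by finitely many bad parameters and their
  orbits. This ring varies with the chosen parameters, and so does the constant
  \<open>\<delta>\<close> with which \<open>gap\<close> survives the extension. That is harmless:
  applied to the powers of one element, \<open>gap\<close> improves any \<open>\<delta>\<close> to
  1. Only the cost of a generator has to be uniform, and it is, because some power of each generator
  equals a combination of shorter words in generators whose coefficients come from \<open>f\<close>
  and \<open>a\<close> alone. The other obstacle is denominators. If \<open>q\<close> clears those
  of the coefficients, only \<open>q * y\<close> is integral for a generator \<open>y\<close>, so a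
  monomial of degree k needs the factor q^k. Over r rows this loss has an exponent of order r^2,
  just like the gain. A high iterate P_J helps: its value at a parameter is a single generator, so
  writing degree k with powers of P_J takes only about k / deg P_J factors. Hence two families of
  polynomials are compared in one determinant, powers of P_J for integrality and powers of P_n - Q_n
  for small cost.\<close>

text \<open>\<open>L\<close> plays the role of a ring of integers and \<open>C x u\<close> says that an archimedean size of
  \<open>x\<close>, an element of the fraction field of \<open>L\<close>, is at most \<open>u\<close>. The axiom \<open>gap\<close> takes the
  place of the product formula.\<close>

locale cost_ring =
  fixes L :: "complex set" and C :: "complex \<Rightarrow> real \<Rightarrow> bool"
  assumes minus_one: "-1 \<in> L"
    and L_add: "x \<in> L \<Longrightarrow> y \<in> L \<Longrightarrow> x + y \<in> L"
    and L_mult: "x \<in> L \<Longrightarrow> y \<in> L \<Longrightarrow> x * y \<in> L"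
    and L_cost: "x \<in> L \<Longrightarrow> \<exists>u. C x u"
    and C_rat: "C (of_rat a) \<bar>of_rat a\<bar>"
    and C_add: "C x u \<Longrightarrow> C y v \<Longrightarrow> C (x + y) (u + v)"
    and C_mult: "C x u \<Longrightarrow> C y v \<Longrightarrow> C (x * y) (u * v)"
    and C_mono: "C x u \<Longrightarrow> u \<le> v \<Longrightarrow> C x v"
    and C_nonneg: "C x u \<Longrightarrow> 0 \<le> u"
    and clear: "C x u \<Longrightarrow> \<exists>q\<in>L. q \<noteq> 0 \<and> q * x \<in> L"
    and gap: "\<exists>\<delta>>0. \<forall>x\<in>L. x \<noteq> 0 \<longrightarrow> (\<forall>u. C x u \<longrightarrow> \<delta> \<le> u)"
begin

definition A :: "complex set" where "A = {x. \<exists>u. C x u}"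

lemma one_L: "1 \<in> L"
  using L_mult[OF minus_one minus_one] by simp

lemma zero_L: "0 \<in> L"
  using L_add[OF minus_one one_L] by simp

lemma L_uminus: "x \<in> L \<Longrightarrow> - x \<in> L"
  using L_mult[OF minus_one] by force

lemma L_power: "x \<in> L \<Longrightarrow> x ^ n \<in> L"
  by (induction n) (auto simp: one_L L_mult)

lemma L_sum: "(\<And>i. i \<in> I \<Longrightarrow> h i \<in> L) \<Longrightarrow> sum h I \<in> L"
  by (induction I rule: infinite_finite_induct) (auto simp: zero_L L_add)

lemma L_prod: "(\<And>i. i \<in> I \<Longrightarrow> h i \<in> L) \<Longrightarrow> prod h I \<in> L"
  by (induction I rule: infinite_finite_induct) (auto simp: one_L L_mult)

lemma L_A: "x \<in> L \<Longrightarrow> x \<in> A"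
  unfolding A_def using L_cost by blast

lemma C_0: "C 0 0"
  using C_rat[of 0] by simp

lemma C_1: "C 1 1"
  using C_rat[of 1] by simp

lemma C_uminus: "C x u \<Longrightarrow> C (- x) u"
  using C_mult[OF C_rat[of "-1"], of x u] by (simp add: of_rat_minus)

lemma C_diff: "C x u \<Longrightarrow> C y v \<Longrightarrow> C (x - y) (u + v)"
  using C_add[of x u "- y" v] C_uminus by simp

lemma C_inverse_nat: "C (1 / of_nat n) (1 / of_nat n)"
  using C_rat[of "1 / of_nat n"] by (simp add: of_rat_divide)

lemma C_power: "C x u \<Longrightarrow> C (x ^ n) (u ^ n)"
  by (induction n) (auto simp: C_1 C_mult)

lemma C_sum: "finite I \<Longrightarrow> (\<And>i. i \<in> I \<Longrightarrow> C (h i) (u i)) \<Longrightarrow> C (sum h I) (sum u I)"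
  by (induction I rule: finite_induct) (auto simp: C_0 C_add)

lemma C_prod: "finite I \<Longrightarrow> (\<And>i. i \<in> I \<Longrightarrow> C (h i) (u i)) \<Longrightarrow> C (prod h I) (prod u I)"
  by (induction I rule: finite_induct) (auto simp: C_1 C_mult)

lemma A_rat: "of_rat a \<in> A"
  unfolding A_def using C_rat by blast

lemma A_0: "0 \<in> A" and A_1: "1 \<in> A"
  using A_rat[of 0] A_rat[of 1] by auto

lemma A_add: "x \<in> A \<Longrightarrow> y \<in> A \<Longrightarrow> x + y \<in> A"
  unfolding A_def using C_add by blast

lemma A_mult: "x \<in> A \<Longrightarrow> y \<in> A \<Longrightarrow> x * y \<in> A"
  unfolding A_def using C_mult by blast

lemma A_diff: "x \<in> A \<Longrightarrow> y \<in> A \<Longrightarrow> x - y \<in> A"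
  unfolding A_def using C_diff by blast

lemma common_clear:
  assumes "finite S" "S \<subseteq> A"
  obtains q where "q \<in> L" "q \<noteq> 0" "\<And>x. x \<in> S \<Longrightarrow> q * x \<in> L"
proof -
  from assms have "\<exists>q\<in>L. q \<noteq> 0 \<and> (\<forall>x\<in>S. q * x \<in> L)"
  proof (induction S rule: finite_induct)
    case empty
    show ?case using one_L by (intro bexI[of _ 1]) auto
  next
    case (insert y S)
    then obtain q where q: "q \<in> L" "q \<noteq> 0" "\<And>x. x \<in> S \<Longrightarrow> q * x \<in> L" by auto
    from insert.prems obtain q' where q': "q' \<in> L" "q' \<noteq> 0" "q' * y \<in> L"
      unfolding A_def using clear by blast
    show ?case
    proof (intro bexI[of _ "q * q'"] conjI ballI)
      show "q * q' \<noteq> 0" "q * q' \<in> L" using q q' L_mult by auto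
      fix x assume "x \<in> insert y S"
      then show "q * q' * x \<in> L"
        using L_mult[OF q(1) q'(3)] L_mult[OF q'(1) q(3)[of x]] by (auto simp: mult_ac)
    qed
  qed
  then show ?thesis using that by blast
qed

lemma common_cost:
  assumes "finite S" "S \<subseteq> A"
  obtains T where "T \<ge> 1" "\<And>x. x \<in> S \<Longrightarrow> C x T"
proof -
  from assms have "\<exists>T\<ge>1. \<forall>x\<in>S. C x T"
  proof (induction S rule: finite_induct)
    case empty
    show ?case by (intro exI[of _ 1]) auto
  next
    case (insert y S)
    then obtain T where T: "T \<ge> 1" "\<And>x. x \<in> S \<Longrightarrow> C x T" by auto
    from insert.prems obtain u where u: "C y u" unfolding A_def by blast
    show ?case
      using T u C_mono by (intro exI[of _ "max T u"]) fastforce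
  qed
  then show ?thesis using that by blast
qed

text \<open>If \<open>u < 1\<close>, the powers of \<open>x\<close> would be nonzero elements of
  \<open>L\<close> whose costs tend to 0, against \<open>gap\<close>.\<close>

lemma power_gap:
  assumes "x \<in> L" "x \<noteq> 0" "C x u"
  shows "1 \<le> u"
proof (rule ccontr)
  assume "\<not> 1 \<le> u"
  moreover have "0 \<le> u" using assms C_nonneg by blast
  ultimately have lim: "(\<lambda>n. u ^ n) \<longlonglongrightarrow> 0" by (intro LIMSEQ_power_zero) auto
  from gap obtain \<delta> where \<delta>: "\<delta> > 0" "\<And>x u. x \<in> L \<Longrightarrow> x \<noteq> 0 \<Longrightarrow> C x u \<Longrightarrow> \<delta> \<le> u" by blast
  have "\<delta> \<le> u ^ n" for n
    using \<delta>(2)[of "x ^ n" "u ^ n"] assms L_power C_power by auto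
  then have "\<delta> \<le> 0" using lim by (intro LIMSEQ_le_const) auto
  with \<delta>(1) show False by simp
qed

text \<open>The functionals \<open>\<psi> \<in> \<Psi>\<close> replace coordinates with respect to a basis of the span of the
  \<open>ev e\<close>: this span need not be free over \<open>L\<close>, but it embeds in a free module.\<close>

lemma separating_functionals:
  assumes "finite E"
  shows "\<exists>\<Psi>. finite \<Psi> \<and> (\<forall>\<psi>\<in>\<Psi>. \<forall>e\<in>E. \<psi> e \<in> L) \<and>
    (\<forall>a. (\<forall>e\<in>E. a e \<in> A) \<longrightarrow>
      ((\<Sum>e\<in>E. a e * ev e) = 0 \<longleftrightarrow> (\<forall>\<psi>\<in>\<Psi>. (\<Sum>e\<in>E. a e * \<psi> e) = 0)))"
  using assms
proof (induction E rule: finite_induct)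
  case empty
  show ?case by (intro exI[of _ "{}"]) auto
next
  case (insert e' E)
  from insert.IH obtain \<Psi> where \<Psi>: "finite \<Psi>" "\<forall>\<psi>\<in>\<Psi>. \<forall>e\<in>E. \<psi> e \<in> L"
    "\<forall>a. (\<forall>e\<in>E. a e \<in> A) \<longrightarrow>
      ((\<Sum>e\<in>E. a e * ev e) = 0 \<longleftrightarrow> (\<forall>\<psi>\<in>\<Psi>. (\<Sum>e\<in>E. a e * \<psi> e) = 0))"
    by (elim exE conjE)
  note sep = \<Psi>(3)[rule_format]
  have ne: "e \<noteq> e'" if "e \<in> E" for e using that insert.hyps by auto
  show ?case
  proof (cases "\<exists>s a. s \<in> A \<and> s \<noteq> 0 \<and> (\<forall>e\<in>E. a e \<in> A) \<and> s * ev e' + (\<Sum>e\<in>E. a e * ev e) = 0")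
    case False
    \<comment> \<open>Here \<open>ev e'\<close> is independent of the other values over
      \<open>A\<close>, so its coefficient in a vanishing combination is 0. A coordinate functional
      tests this; the old functionals, extended by 0, test the rest.\<close>
    define ext where "ext = (\<lambda>\<psi> :: 'a \<Rightarrow> complex. \<psi>(e' := 0))"
    define \<Psi>' where "\<Psi>' = insert (\<lambda>e. if e = e' then 1 else 0) (ext ` \<Psi>)"
    show ?thesis
    proof (intro exI[of _ \<Psi>'] conjI ballI allI impI)
      show "finite \<Psi>'" using \<Psi>(1) by (simp add: \<Psi>'_def)
      show "\<psi> e \<in> L" if "\<psi> \<in> \<Psi>'" "e \<in> insert e' E" for \<psi> e
        using that \<Psi>(2) by (auto simp: \<Psi>'_def ext_def one_L zero_L)
      fix a assume a: "\<forall>e\<in>insert e' E. a e \<in> A"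
      have s: "(\<Sum>e\<in>insert e' E. a e * \<phi> e) = a e' * \<phi> e' + (\<Sum>e\<in>E. a e * \<phi> e)"
        for \<phi> :: "'a \<Rightarrow> complex" using insert.hyps by simp
      have 1: "(\<Sum>e\<in>insert e' E. a e * (if e = e' then 1 else 0)) = a e'"
        unfolding s using ne by (simp cong: sum.cong)
      have 2: "(\<Sum>e\<in>insert e' E. a e * ext \<psi> e) = (\<Sum>e\<in>E. a e * \<psi> e)" for \<psi>
        unfolding s by (auto simp: ext_def ne intro!: sum.cong)
      have 3: "a e' = 0" if "(\<Sum>e\<in>insert e' E. a e * ev e) = 0"
        using False that a unfolding s by blast
      have "(\<Sum>e\<in>insert e' E. a e * ev e) = 0 \<longleftrightarrow> a e' = 0 \<and> (\<Sum>e\<in>E. a e * ev e) = 0"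
        using 3 unfolding s by auto
      then show "(\<Sum>e\<in>insert e' E. a e * ev e) = 0 \<longleftrightarrow>
         (\<forall>\<psi>\<in>\<Psi>'. (\<Sum>e\<in>insert e' E. a e * \<psi> e) = 0)"
        unfolding \<Psi>'_def using 1 2 sep[of a] a by simp
    qed
  next
    case True
    then obtain s0 a0 where sa: "s0 \<in> A" "s0 \<noteq> 0" "\<And>e. e \<in> E \<Longrightarrow> a0 e \<in> A"
      "s0 * ev e' + (\<Sum>e\<in>E. a0 e * ev e) = 0" by blast
    have "finite (insert s0 (a0 ` E))" "insert s0 (a0 ` E) \<subseteq> A"
      using sa insert.hyps by auto
    then obtain p where p': "p \<in> L" "p \<noteq> 0" "\<And>x. x \<in> insert s0 (a0 ` E) \<Longrightarrow> p * x \<in> L"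
      using common_clear by blast
    then have p: "p \<in> L" "p \<noteq> 0" "p * s0 \<in> L" "\<And>e. e \<in> E \<Longrightarrow> p * a0 e \<in> L"
      by auto
    define s where "s = p * s0"
    define c where "c = (\<lambda>e. - (p * a0 e))"
    have s: "s \<in> L" "s \<noteq> 0" using p sa by (auto simp: s_def)
    have c: "c e \<in> L" if "e \<in> E" for e using p(4)[OF that] L_uminus by (simp add: c_def)
    have rel: "s * ev e' = (\<Sum>e\<in>E. c e * ev e)"
    proof -
      have "p * (s0 * ev e' + (\<Sum>e\<in>E. a0 e * ev e)) = 0" using sa by simp
      then show ?thesis
        by (simp add: s_def c_def distrib_left sum_distrib_left sum_negf mult.assoc eq_neg_iff_add_eq_0)
    qed
    \<comment> \<open>Dividing \<open>rel\<close> by \<open>s\<close> could leave \<open>L\<close>.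
      So each old functional is multiplied by \<open>s\<close> and then extended to
      \<open>e'\<close> in the only way compatible with \<open>rel\<close>.\<close>
    define ext where "ext = (\<lambda>\<psi> e. if e = e' then (\<Sum>e\<in>E. c e * \<psi> e) else s * \<psi> e)"
    show ?thesis
    proof (intro exI[of _ "ext ` \<Psi>"] conjI ballI allI impI)
      show "finite (ext ` \<Psi>)" using \<Psi>(1) by simp
      show "\<psi> e \<in> L" if "\<psi> \<in> ext ` \<Psi>" "e \<in> insert e' E" for \<psi> e
        using that \<Psi>(2) s c by (auto simp: ext_def intro!: L_sum L_mult)
      fix a assume a: "\<forall>e\<in>insert e' E. a e \<in> A"
      \<comment> \<open>The coefficients of \<open>s\<close> times the combination, once
        \<open>e'\<close> is eliminated by \<open>rel\<close>.\<close>
      define b where "b = (\<lambda>e. s * a e + a e' * c e)"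
      have b: "b e \<in> A" if "e \<in> E" for e
        unfolding b_def using a that L_A[OF s(1)] L_A[OF c[OF that]] by (simp add: A_add A_mult)
      have "s * (\<Sum>e\<in>insert e' E. a e * ev e) = a e' * (s * ev e') + (\<Sum>e\<in>E. s * a e * ev e)"
        using insert.hyps by (simp add: sum_distrib_left algebra_simps)
      also have "\<dots> = (\<Sum>e\<in>E. b e * ev e)"
        unfolding rel b_def by (simp add: sum.distrib sum_distrib_left algebra_simps)
      finally have 1: "(\<Sum>e\<in>insert e' E. a e * ev e) = 0 \<longleftrightarrow> (\<Sum>e\<in>E. b e * ev e) = 0"
        using s by (metis mult_eq_0_iff)
      have 2: "(\<Sum>e\<in>insert e' E. a e * ext \<psi> e) = (\<Sum>e\<in>E. b e * \<psi> e)" for \<psi>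
      proof -
        have "(\<Sum>e\<in>insert e' E. a e * ext \<psi> e) = a e' * (\<Sum>e\<in>E. c e * \<psi> e) + (\<Sum>e\<in>E. a e * (s * \<psi> e))"
          using insert.hyps ne by (auto simp: ext_def intro!: sum.cong)
        then show ?thesis
          by (simp add: b_def sum.distrib sum_distrib_left algebra_simps)
      qed
      show "(\<Sum>e\<in>insert e' E. a e * ev e) = 0 \<longleftrightarrow>
         (\<forall>\<psi>\<in>ext ` \<Psi>. (\<Sum>e\<in>insert e' E. a e * \<psi> e) = 0)"
        unfolding 1 using 2 sep[of b] b by simp
    qed
  qed
qed

end

section \<open>Adjoining generators\<close>

text \<open>The equations that the generators will satisfy have coefficients in \<open>A\<close>
  rather than in \<open>L\<close>. The element \<open>q\<close> is meant to clear their
  denominators, so \<open>q * y\<close> will count as integral, while \<open>y\<close> itself only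
  receives the cost \<open>R\<close>.\<close>

locale cost_ring_extension = cost_ring +
  fixes Y :: "complex set" and q :: complex and R :: real
  assumes fin_Y: "finite Y" and q_L: "q \<in> L" and q_nz: "q \<noteq> 0" and R_ge_1: "R \<ge> 1"
begin

text \<open>The quotient seminorm of the coefficient-sum norm on polynomials over \<open>A\<close>
  in the elements of \<open>Y\<close>, each variable having weight \<open>R\<close>.\<close>

inductive rep :: "complex \<Rightarrow> real \<Rightarrow> bool" where
  base: "C x u \<Longrightarrow> rep x u"
| gen: "rep x u \<Longrightarrow> y \<in> Y \<Longrightarrow> rep (y * x) (R * u)"
| add: "rep x u \<Longrightarrow> rep x' u' \<Longrightarrow> rep (x + x') (u + u')"
| mono: "rep x u \<Longrightarrow> u \<le> v \<Longrightarrow> rep x v"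

inductive_set lat :: "complex set" where
  lat_base: "x \<in> L \<Longrightarrow> x \<in> lat"
| lat_gen: "x \<in> lat \<Longrightarrow> y \<in> Y \<Longrightarrow> q * y * x \<in> lat"
| lat_add: "x \<in> lat \<Longrightarrow> x' \<in> lat \<Longrightarrow> x + x' \<in> lat"

lemma rep_nonneg: "rep x u \<Longrightarrow> 0 \<le> u"
  by (induction rule: rep.induct) (use R_ge_1 in \<open>auto simp: C_nonneg\<close>)

lemma rep_C_mult: "rep x' u' \<Longrightarrow> C x u \<Longrightarrow> rep (x * x') (u * u')"
proof (induction arbitrary: x u rule: rep.induct)
  case (base x' u')
  then show ?case using C_mult rep.base by blast
next
  case (gen x' u' y)
  then have "rep (y * (x * x')) (R * (u * u'))" using rep.gen by blast
  then show ?case by (simp add: mult_ac)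
next
  case (add x1 u1 x2 u2)
  then show ?case using rep.add by (simp add: distrib_left)
next
  case (mono x' u' v)
  then show ?case using C_nonneg rep.mono[of "x * x'" "u * u'" "u * v"] by (simp add: mult_left_mono)
qed

lemma rep_mult: "rep x u \<Longrightarrow> rep x' u' \<Longrightarrow> rep (x * x') (u * u')"
proof (induction arbitrary: x' u' rule: rep.induct)
  case (base x u)
  then show ?case using rep_C_mult by blast
next
  case (gen x u y)
  then have "rep (y * (x * x')) (R * (u * u'))" using rep.gen by blast
  then show ?case by (simp add: mult_ac)
next
  case (add x1 u1 x2 u2)
  then show ?case using rep.add by (simp add: distrib_right)
next
  case (mono x u v)
  then show ?case using rep_nonneg rep.mono[of "x * x'" "u * u'" "v * u'"] by (simp add: mult_right_mono)
qed

lemma rep_gen_1: "y \<in> Y \<Longrightarrow> rep y R"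
  using gen[OF base[OF C_1], of y] by simp

lemma lat_gen_1: "y \<in> Y \<Longrightarrow> q * y \<in> lat"
  using lat_gen[OF lat_base[OF one_L], of y] by simp

lemma lat_L_mult: "x' \<in> lat \<Longrightarrow> x \<in> L \<Longrightarrow> x * x' \<in> lat"
proof (induction arbitrary: x rule: lat.induct)
  case (lat_base x')
  then show ?case using L_mult lat.lat_base by blast
next
  case (lat_gen x' y)
  then have "q * y * (x * x') \<in> lat" using lat.lat_gen by blast
  then show ?case by (simp add: mult_ac)
next
  case (lat_add x1 x2)
  then show ?case using lat.lat_add by (simp add: distrib_left)
qed

lemma lat_mult: "x \<in> lat \<Longrightarrow> x' \<in> lat \<Longrightarrow> x * x' \<in> lat"
proof (induction arbitrary: x' rule: lat.induct)
  case (lat_base x)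
  then show ?case using lat_L_mult by blast
next
  case (lat_gen x y)
  then have "q * y * (x * x') \<in> lat" using lat.lat_gen by blast
  then show ?case by (simp add: mult_ac)
next
  case (lat_add x1 x2)
  then show ?case using lat.lat_add by (simp add: distrib_right)
qed

lemma lat_rep: "x \<in> lat \<Longrightarrow> \<exists>u. rep x u"
proof (induction rule: lat.induct)
  case (lat_base x)
  then show ?case using L_cost base by blast
next
  case (lat_gen x y)
  then show ?case using rep_mult rep_gen_1 L_cost[OF q_L] base by meson
next
  case (lat_add x x')
  then show ?case using add by blast
qed

lemma rep_clear: "rep x u \<Longrightarrow> \<exists>s\<in>L. s \<noteq> 0 \<and> s * x \<in> lat"
proof (induction rule: rep.induct)
  case (base x u)
  then show ?case using clear lat_base by blast
next
  case (gen x u y)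
  then obtain s where s: "s \<in> L" "s \<noteq> 0" "s * x \<in> lat" by blast
  have "(s * q) * (y * x) = q * y * (s * x)" by simp
  then show ?case
    using s q_L q_nz L_mult lat_gen[OF s(3) gen.hyps(2)] by (metis mult_eq_0_iff)
next
  case (add x u x' u')
  then obtain s s' where s: "s \<in> L" "s \<noteq> 0" "s * x \<in> lat" and s': "s' \<in> L" "s' \<noteq> 0" "s' * x' \<in> lat"
    by blast
  have "s * s' * (x + x') = s' * (s * x) + s * (s' * x')" by (simp add: algebra_simps)
  then have "s * s' * (x + x') \<in> lat"
    using s s' lat_L_mult lat_add by metis
  then show ?case using s s' L_mult by (metis mult_eq_0_iff)
qed auto

lemma cost_ring_ext:
  assumes "\<exists>\<delta>>0. \<forall>x\<in>lat. x \<noteq> 0 \<longrightarrow> (\<forall>u. rep x u \<longrightarrow> \<delta> \<le> u)"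
  shows "cost_ring lat rep"
proof
  show "-1 \<in> lat" using minus_one lat_base by blast
  show "rep (of_rat a) \<bar>of_rat a\<bar>" for a using C_rat base by blast
  show "rep x u \<Longrightarrow> u \<le> v \<Longrightarrow> rep x v" for x u v by (rule mono)
  show "\<exists>q\<in>lat. q \<noteq> 0 \<and> q * x \<in> lat" if "rep x u" for x u
    using rep_clear[OF that] lat_base by blast
  show "\<exists>\<delta>>0. \<forall>x\<in>lat. x \<noteq> 0 \<longrightarrow> (\<forall>u. rep x u \<longrightarrow> \<delta> \<le> u)" by (fact assms)
qed (fact lat_add lat_mult lat_rep add rep_mult rep_nonneg)+

text \<open>\<open>comb l n x u\<close>: \<open>x\<close> is a combination of words in \<open>Y\<close> of length at most \<open>l\<close>, of total cost
  at most \<open>u\<close>, whose coefficients are such that \<open>q ^ n * x\<close> is a combination over \<open>L\<close> of words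
  in the elements \<open>q * y\<close>.\<close>

inductive comb :: "nat \<Rightarrow> nat \<Rightarrow> complex \<Rightarrow> real \<Rightarrow> bool" for l n where
  comb_term: "C b v \<Longrightarrow> set ys \<subseteq> Y \<Longrightarrow> length ys \<le> l \<Longrightarrow> length ys \<le> n \<Longrightarrow>
    q ^ (n - length ys) * b \<in> L \<Longrightarrow> comb l n (b * prod_list ys) (v * R ^ length ys)"
| comb_add: "comb l n x u \<Longrightarrow> comb l n x' u' \<Longrightarrow> comb l n (x + x') (u + u')"
| comb_mono: "comb l n x u \<Longrightarrow> u \<le> v \<Longrightarrow> comb l n x v"

lemma comb_nonneg: "comb l n x u \<Longrightarrow> 0 \<le> u"
  by (induction rule: comb.induct) (use R_ge_1 in \<open>auto simp: C_nonneg\<close>)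

lemma comb_le: "comb l n x u \<Longrightarrow> l \<le> l' \<Longrightarrow> comb l' n x u"
proof (induction rule: comb.induct)
  case (comb_term b v ys)
  then show ?case by (intro comb.comb_term) auto
next
  case (comb_add x u x' u')
  then show ?case by (intro comb.comb_add) auto
next
  case (comb_mono x u v)
  then show ?case using comb.comb_mono by auto
qed

lemma comb_term_mult:
  assumes "comb l' n' x' u'"
  shows "C b v \<Longrightarrow> set ys \<subseteq> Y \<Longrightarrow> length ys \<le> l \<Longrightarrow> length ys \<le> n \<Longrightarrow> q ^ (n - length ys) * b \<in> L \<Longrightarrow>
    comb (l + l') (n + n') (b * prod_list ys * x') (v * R ^ length ys * u')"
  using assms
proof (induction x' u' rule: comb.induct)
  case (comb_term b' v' ys')
  have "n + n' - length (ys @ ys') = (n - length ys) + (n' - length ys')"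
    using comb_term by simp
  then have "q ^ (n + n' - length (ys @ ys')) * (b * b')
      = (q ^ (n - length ys) * b) * (q ^ (n' - length ys') * b')"
    by (simp add: power_add)
  then have "q ^ (n + n' - length (ys @ ys')) * (b * b') \<in> L"
    using comb_term L_mult by metis
  moreover have "C (b * b') (v * v')" using comb_term C_mult by blast
  ultimately have "comb (l + l') (n + n') ((b * b') * prod_list (ys @ ys')) ((v * v') * R ^ length (ys @ ys'))"
    using comb_term by (intro comb.comb_term) auto
  then show ?case by (simp add: power_add mult_ac)
next
  case (comb_add x1 u1 x2 u2)
  then show ?case using comb.comb_add by (simp add: distrib_left)
next
  case (comb_mono x' u' w)
  have "0 \<le> v * R ^ length ys" using comb_mono.prems(1) C_nonneg R_ge_1 by simp
  then have "v * R ^ length ys * u' \<le> v * R ^ length ys * w"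
    using comb_mono.hyps(2) by (rule mult_left_mono[rotated])
  then show ?case using comb_mono comb.comb_mono by blast
qed

lemma comb_mult:
  "comb l n x u \<Longrightarrow> comb l' n' x' u' \<Longrightarrow> comb (l + l') (n + n') (x * x') (u * u')"
proof (induction rule: comb.induct)
  case (comb_term b v ys)
  then show ?case using comb_term_mult by blast
next
  case (comb_add x1 u1 x2 u2)
  then show ?case using comb.comb_add by (simp add: distrib_right)
next
  case (comb_mono x u w)
  then have "u * u' \<le> w * u'" using comb_nonneg by (intro mult_right_mono) auto
  then show ?case using comb_mono comb.comb_mono by blast
qed

lemma comb_sum:
  "finite I \<Longrightarrow> (\<And>i. i \<in> I \<Longrightarrow> comb l n (h i) (w i)) \<Longrightarrow> comb l n (sum h I) (sum w I)"
proof (induction I rule: finite_induct)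
  case empty
  show ?case using comb_term[of 0 0 "[]"] C_0 zero_L by simp
qed (auto intro: comb_add)

lemma comb_word: "set ys \<subseteq> Y \<Longrightarrow> comb (length ys) (length ys) (prod_list ys) (R ^ length ys)"
  using comb_term[of 1 1 ys "length ys" "length ys"] by (simp add: C_1 one_L)

text \<open>A word shorter than \<open>e\<close> leaves a spare factor \<open>q\<close> in weight
  \<open>e\<close>, and this factor clears the denominator of \<open>b\<close>.\<close>

lemma comb_single:
  assumes "C b T" "q * b \<in> L" "set ys \<subseteq> Y" "length ys < e"
  shows "comb (e - 1) e (b * prod_list ys) (T * R ^ (e - 1))"
proof -
  have "q ^ (e - length ys) * b = q ^ (e - length ys - 1) * (q * b)"
    using assms(4) by (simp add: mult.assoc[symmetric] power_Suc2[symmetric] Suc_diff_Suc del: power_Suc)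
  moreover have "q ^ (e - length ys - 1) * (q * b) \<in> L"
    using L_mult[OF L_power[OF q_L] assms(2)] .
  ultimately have "q ^ (e - length ys) * b \<in> L" by (simp only:)
  then have "comb (e - 1) e (b * prod_list ys) (T * R ^ length ys)"
    using assms by (intro comb_term) auto
  moreover have "T * R ^ length ys \<le> T * R ^ (e - 1)"
    using assms C_nonneg R_ge_1 by (intro mult_left_mono power_increasing) auto
  ultimately show ?thesis by (rule comb_mono)
qed

lemma comb_poly:
  assumes "\<And>i. i < e \<Longrightarrow> C (b i) T" "\<And>i. i < e \<Longrightarrow> q * b i \<in> L" "x \<in> Y" "n \<le> e"
  shows "comb (e - 1) e (\<Sum>i<n. b i * x ^ i) (real n * T * R ^ (e - 1))"
proof -
  have "comb (e - 1) e (\<Sum>i<n. b i * prod_list (replicate i x)) (\<Sum>i<n. T * R ^ (e - 1))"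
    using assms by (intro comb_sum comb_single) auto
  then show ?thesis by (simp add: prod_list_replicate mult.assoc)
qed

end

lemma count_list_split:
  "e \<le> count_list ys y \<Longrightarrow>
    \<exists>zs. length ys = e + length zs \<and> set zs \<subseteq> set ys \<and> prod_list ys = (y :: 'a :: comm_monoid_mult) ^ e * prod_list zs"
proof (induction ys arbitrary: e)
  case (Cons z ys)
  show ?case
  proof (cases "z = y \<and> e > 0")
    case True
    with Cons.prems have "e - 1 \<le> count_list ys y" by simp
    from Cons.IH[OF this] obtain zs where "length ys = e - 1 + length zs" "set zs \<subseteq> set ys"
      "prod_list ys = y ^ (e - 1) * prod_list zs" by blast
    with True show ?thesis
      by (intro exI[of _ zs]) (auto simp: mult.assoc[symmetric] power_Suc[symmetric] simp del: power_Suc)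
  next
    case False
    with Cons.prems have "e \<le> count_list ys y" by (cases "z = y") auto
    from Cons.IH[OF this] obtain zs where "length ys = e + length zs" "set zs \<subseteq> set ys"
      "prod_list ys = y ^ e * prod_list zs" by blast
    then show ?thesis by (intro exI[of _ "z # zs"]) (auto simp: mult_ac)
  qed
qed auto

text \<open>Each relation trades \<open>dg y\<close> occurrences of \<open>y\<close> for shorter words without raising the cost,
  so words of bounded length suffice.\<close>

locale integral_extension = cost_ring_extension +
  fixes dg :: "complex \<Rightarrow> nat"
  assumes dg_pos: "y \<in> Y \<Longrightarrow> dg y \<ge> 1"
    and relation: "y \<in> Y \<Longrightarrow> comb (dg y - 1) (dg y) (y ^ dg y) (R ^ dg y)"
begin

definition S :: nat where "S = sum dg Y"

definition E :: "complex list set" where "E = {ys. set ys \<subseteq> Y \<and> length ys \<le> S}"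

lemma fin_E: "finite E"
  unfolding E_def using finite_lists_length_le[OF fin_Y] by simp

text \<open>Pigeonhole: a word of length above \<open>S\<close> contains some \<open>y\<close> at
  least \<open>dg y\<close> times. The relation replaces these occurrences, whose share of the cost
  is exactly the bound \<open>R ^ dg y\<close> in \<open>relation\<close>.\<close>

lemma comb_step: "comb l n x u \<Longrightarrow> l > S \<Longrightarrow> comb (l - 1) n x u"
proof (induction rule: comb.induct)
  case (comb_term b v ys)
  show ?case
  proof (cases "length ys = l")
    case False
    with comb_term show ?thesis by (intro comb.comb_term) auto
  next
    case True
    have "\<exists>y\<in>Y. dg y \<le> count_list ys y"
    proof (rule ccontr)
      assume "\<not> ?thesis"
      then have "sum (count_list ys) Y \<le> S"
        unfolding S_def by (intro sum_mono) auto
      then show False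
        using sum_count_set[OF comb_term.hyps(2) fin_Y] True comb_term.prems by simp
    qed
    then obtain y where y: "y \<in> Y" "dg y \<le> count_list ys y" by blast
    from count_list_split[OF y(2)] obtain zs where zs: "length ys = dg y + length zs" "set zs \<subseteq> set ys"
      "prod_list ys = y ^ dg y * prod_list zs" by blast
    have "comb (length zs) (n - dg y) (b * prod_list zs) (v * R ^ length zs)"
      using comb_term zs by (intro comb.comb_term) auto
    from comb_mult[OF relation[OF y(1)] this]
    have "comb (dg y - 1 + length zs) (dg y + (n - dg y)) (y ^ dg y * (b * prod_list zs))
        (R ^ dg y * (v * R ^ length zs))" .
    moreover have "dg y - 1 + length zs = l - 1" "dg y + (n - dg y) = n"
      using dg_pos[OF y(1)] zs True comb_term.hyps(4) by auto
    ultimately show ?thesis using zs by (simp add: power_add mult_ac)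
  qed
next
  case (comb_add x u x' u')
  then show ?case by (intro comb.comb_add) auto
next
  case (comb_mono x u v)
  then show ?case using comb.comb_mono by auto
qed

lemma comb_reduce: "comb l n x u \<Longrightarrow> comb S n x u"
proof (induction l)
  case 0
  then show ?case using comb_le by blast
next
  case (Suc l)
  then show ?case using comb_le[of "Suc l"] comb_step[of "Suc l"] by (cases "Suc l \<le> S") auto
qed

text \<open>The expansion of small cost and the integral one (\<open>span_lat\<close>) of the same
  element are chosen independently of each other; only \<open>gap_integral\<close> relates
  them.\<close>

definition span_cost :: "complex \<Rightarrow> real \<Rightarrow> bool" where
  "span_cost x u \<longleftrightarrow> (\<exists>a v. (\<forall>e\<in>E. C (a e) (v e)) \<and> x = (\<Sum>e\<in>E. a e * prod_list e) \<and>
     (\<Sum>e\<in>E. v e * R ^ length e) \<le> u)"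

definition span_lat :: "complex \<Rightarrow> bool" where
  "span_lat x \<longleftrightarrow> (\<exists>a. (\<forall>e\<in>E. a e \<in> L) \<and> x = (\<Sum>e\<in>E. a e * (q ^ length e * prod_list e)))"

lemma span_cost_mono:
  assumes "span_cost x u" "u \<le> v"
  shows "span_cost x v"
proof -
  from assms obtain a w where h: "\<forall>e\<in>E. C (a e) (w e)" "x = (\<Sum>e\<in>E. a e * prod_list e)"
     "(\<Sum>e\<in>E. w e * R ^ length e) \<le> u" unfolding span_cost_def by blast
  show ?thesis unfolding span_cost_def
    by (rule exI[of _ a], rule exI[of _ w]) (use h assms(2) in auto)
qed

lemma span_cost_add:
  assumes "span_cost x u" "span_cost x' u'"
  shows "span_cost (x + x') (u + u')"
proof -
  from assms obtain a v a' v' where h: "\<forall>e\<in>E. C (a e) (v e)" "x = (\<Sum>e\<in>E. a e * prod_list e)"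
     "(\<Sum>e\<in>E. v e * R ^ length e) \<le> u" "\<forall>e\<in>E. C (a' e) (v' e)" "x' = (\<Sum>e\<in>E. a' e * prod_list e)"
     "(\<Sum>e\<in>E. v' e * R ^ length e) \<le> u'" unfolding span_cost_def by blast
  show ?thesis unfolding span_cost_def
    by (rule exI[of _ "\<lambda>e. a e + a' e"], rule exI[of _ "\<lambda>e. v e + v' e"])
      (use h in \<open>auto simp: C_add distrib_right sum.distrib\<close>)
qed

lemma span_cost_scale:
  assumes "span_cost x u" "C b w"
  shows "span_cost (b * x) (w * u)"
proof -
  from assms obtain a v where h: "\<forall>e\<in>E. C (a e) (v e)" "x = (\<Sum>e\<in>E. a e * prod_list e)"
     "(\<Sum>e\<in>E. v e * R ^ length e) \<le> u" unfolding span_cost_def by blast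
  have "w * (\<Sum>e\<in>E. v e * R ^ length e) \<le> w * u"
    using h(3) C_nonneg[OF assms(2)] by (rule mult_left_mono)
  then show ?thesis unfolding span_cost_def
    by (intro exI[of _ "\<lambda>e. b * a e"] exI[of _ "\<lambda>e. w * v e"])
      (use h assms(2) in \<open>auto simp: C_mult sum_distrib_left mult.assoc\<close>)
qed

lemma span_lat_add:
  assumes "span_lat x" "span_lat x'"
  shows "span_lat (x + x')"
proof -
  from assms obtain a a' where h: "\<forall>e\<in>E. a e \<in> L" "x = (\<Sum>e\<in>E. a e * (q ^ length e * prod_list e))"
     "\<forall>e\<in>E. a' e \<in> L" "x' = (\<Sum>e\<in>E. a' e * (q ^ length e * prod_list e))"
    unfolding span_lat_def by blast
  show ?thesis unfolding span_lat_def
    by (intro exI[of _ "\<lambda>e. a e + a' e"]) (use h in \<open>auto simp: L_add distrib_right sum.distrib\<close>)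
qed

lemma span_lat_scale:
  assumes "span_lat x" "b \<in> L"
  shows "span_lat (b * x)"
proof -
  from assms obtain a where h: "\<forall>e\<in>E. a e \<in> L" "x = (\<Sum>e\<in>E. a e * (q ^ length e * prod_list e))"
    unfolding span_lat_def by blast
  show ?thesis unfolding span_lat_def
    by (intro exI[of _ "\<lambda>e. b * a e"]) (use h assms(2) in \<open>auto simp: L_mult sum_distrib_left mult.assoc\<close>)
qed

lemma comb_span:
  assumes "comb S n x u"
  shows "span_cost x u \<and> span_lat (q ^ n * x)"
  using assms
proof (induction rule: comb.induct)
  case (comb_term b v ys)
  have ys: "ys \<in> E" using comb_term by (simp add: E_def)
  have 1: "(\<Sum>e\<in>E. (if e = ys then c else 0) * h e) = c * h ys" for c :: "'a :: comm_ring_1" and h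
    using ys fin_E by (simp add: if_distrib[of "\<lambda>x. x * _"] sum.delta cong: if_cong)
  have "span_cost (b * prod_list ys) (v * R ^ length ys)"
    unfolding span_cost_def
    by (rule exI[of _ "\<lambda>e. if e = ys then b else 0"], rule exI[of _ "\<lambda>e. if e = ys then v else 0"])
      (use comb_term C_0 in \<open>auto simp: 1\<close>)
  moreover have "q ^ n * (b * prod_list ys) = (q ^ (n - length ys) * b) * (q ^ length ys * prod_list ys)"
    using comb_term.hyps(4) by (simp add: mult_ac power_add[symmetric])
  then have "span_lat (q ^ n * (b * prod_list ys))"
    unfolding span_lat_def
    by (intro exI[of _ "\<lambda>e. if e = ys then q ^ (n - length ys) * b else 0"])
      (use comb_term zero_L in \<open>auto simp: 1\<close>)
  ultimately show ?case by blast
next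
  case (comb_add x u x' u')
  then show ?case using span_cost_add span_lat_add by (simp add: distrib_left)
next
  case (comb_mono x u v)
  then show ?case using span_cost_mono by blast
qed

lemma word_span:
  assumes "set ys \<subseteq> Y"
  shows "span_cost (prod_list ys) (R ^ length ys)" "span_lat (q ^ length ys * prod_list ys)"
  using comb_span[OF comb_reduce[OF comb_word[OF assms]]] by auto

lemma span_cost_sum:
  "finite I \<Longrightarrow> (\<And>i. i \<in> I \<Longrightarrow> span_cost (h i) (w i)) \<Longrightarrow> span_cost (sum h I) (sum w I)"
proof (induction I rule: finite_induct)
  case empty
  show ?case using span_cost_scale[OF word_span(1)[of "[]"] C_0] by simp
qed (auto intro: span_cost_add)

lemma span_lat_sum:
  "finite I \<Longrightarrow> (\<And>i. i \<in> I \<Longrightarrow> span_lat (h i)) \<Longrightarrow> span_lat (sum h I)"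
proof (induction I rule: finite_induct)
  case empty
  show ?case using span_lat_scale[OF word_span(2)[of "[]"] zero_L] by simp
qed (auto intro: span_lat_add)

text \<open>Multiplication by a generator lengthens the words of \<open>E\<close> to at most
  \<open>S + 1\<close>, and \<open>word_span\<close> brings them back without raising the
  cost.\<close>

lemma rep_span: "rep x u \<Longrightarrow> span_cost x u"
proof (induction rule: rep.induct)
  case (base x u)
  then show ?case using span_cost_scale[OF word_span(1)[of "[]"], of x u] by simp
next
  case (gen x u y)
  then obtain a v where h: "\<forall>e\<in>E. C (a e) (v e)" "x = (\<Sum>e\<in>E. a e * prod_list e)"
     "(\<Sum>e\<in>E. v e * R ^ length e) \<le> u" unfolding span_cost_def by blast
  have "span_cost (\<Sum>e\<in>E. a e * prod_list (y # e)) (\<Sum>e\<in>E. v e * R ^ length (y # e))"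
    using h gen.hyps by (intro span_cost_sum fin_E span_cost_scale word_span) (auto simp: E_def)
  moreover have "(\<Sum>e\<in>E. a e * prod_list (y # e)) = y * x"
    unfolding h by (simp add: sum_distrib_left mult_ac)
  moreover have "(\<Sum>e\<in>E. v e * R ^ length (y # e)) = R * (\<Sum>e\<in>E. v e * R ^ length e)"
    by (simp add: sum_distrib_left mult_ac)
  moreover have "R * (\<Sum>e\<in>E. v e * R ^ length e) \<le> R * u"
    using h(3) R_ge_1 by (intro mult_left_mono) auto
  ultimately show ?case using span_cost_mono by simp
next
  case (add x u x' u')
  then show ?case using span_cost_add by blast
next
  case (mono x u v)
  then show ?case using span_cost_mono by blast
qed

lemma lat_span: "x \<in> lat \<Longrightarrow> span_lat x"
proof (induction rule: lat.induct)
  case (lat_base x)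
  then show ?case using span_lat_scale[OF word_span(2)[of "[]"], of x] by simp
next
  case (lat_gen x y)
  then obtain a where h: "\<forall>e\<in>E. a e \<in> L" "x = (\<Sum>e\<in>E. a e * (q ^ length e * prod_list e))"
    unfolding span_lat_def by blast
  have "span_lat (\<Sum>e\<in>E. a e * (q ^ length (y # e) * prod_list (y # e)))"
    using h lat_gen.hyps by (intro span_lat_sum fin_E span_lat_scale word_span) (auto simp: E_def)
  moreover have "(\<Sum>e\<in>E. a e * (q ^ length (y # e) * prod_list (y # e))) = q * y * x"
    unfolding h by (simp add: sum_distrib_left mult_ac)
  ultimately show ?case by simp
next
  case (lat_add x x')
  then show ?case using span_lat_add by blast
qed

text \<open>The two expansions of \<open>x\<close> differ by a relation between words, so every
  functional takes the same value on both. The integral expansion puts this value into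
  \<open>L\<close>, the cheap one bounds its cost by \<open>u * T\<close>, and it is nonzero for
  some functional because \<open>x \<noteq> 0\<close>. The gap of \<open>L\<close> thus yields the
  gap \<open>\<delta> / T\<close>.\<close>

theorem gap_integral: "\<exists>\<delta>>0. \<forall>x\<in>lat. x \<noteq> 0 \<longrightarrow> (\<forall>u. rep x u \<longrightarrow> \<delta> \<le> u)"
proof -
  obtain \<Psi> where \<Psi>: "finite \<Psi>" "\<forall>\<psi>\<in>\<Psi>. \<forall>e\<in>E. \<psi> e \<in> L"
    "\<forall>a. (\<forall>e\<in>E. a e \<in> A) \<longrightarrow>
      ((\<Sum>e\<in>E. a e * prod_list e) = 0 \<longleftrightarrow> (\<forall>\<psi>\<in>\<Psi>. (\<Sum>e\<in>E. a e * \<psi> e) = 0))"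
    using separating_functionals[OF fin_E, of prod_list] by (elim exE conjE)
  note sep = \<Psi>(3)[rule_format]
  have "finite (\<Union>\<psi>\<in>\<Psi>. \<psi> ` E)" "(\<Union>\<psi>\<in>\<Psi>. \<psi> ` E) \<subseteq> A"
    using \<Psi>(1,2) fin_E L_A by auto
  then obtain T where T: "T \<ge> 1" "\<And>x. x \<in> (\<Union>\<psi>\<in>\<Psi>. \<psi> ` E) \<Longrightarrow> C x T"
    using common_cost by blast
  obtain \<delta> where \<delta>: "\<delta> > 0" "\<And>x u. x \<in> L \<Longrightarrow> x \<noteq> 0 \<Longrightarrow> C x u \<Longrightarrow> \<delta> \<le> u" using gap by blast
  have "\<delta> / T \<le> u" if x: "x \<in> lat" "x \<noteq> 0" "rep x u" for x u
  proof -
    from lat_span[OF x(1)] obtain a where a: "\<forall>e\<in>E. a e \<in> L"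
      "x = (\<Sum>e\<in>E. a e * (q ^ length e * prod_list e))" unfolding span_lat_def by blast
    from rep_span[OF x(3)] obtain b v where b: "\<forall>e\<in>E. C (b e) (v e)" "x = (\<Sum>e\<in>E. b e * prod_list e)"
     "(\<Sum>e\<in>E. v e * R ^ length e) \<le> u" unfolding span_cost_def by blast
    define a' where "a' = (\<lambda>e. a e * q ^ length e)"
    have a': "a' e \<in> L" if "e \<in> E" for e
      unfolding a'_def using a that q_L L_power L_mult by blast
    have bA: "b e \<in> A" if "e \<in> E" for e using b that unfolding A_def by blast
    have xa: "x = (\<Sum>e\<in>E. a' e * prod_list e)" unfolding a a'_def by (simp add: mult_ac)
    have "(\<Sum>e\<in>E. (a' e - b e) * prod_list e) = 0"
      using xa b(2) by (simp add: left_diff_distrib sum_subtractf)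
    then have eq: "(\<Sum>e\<in>E. a' e * \<psi> e) = (\<Sum>e\<in>E. b e * \<psi> e)" if "\<psi> \<in> \<Psi>" for \<psi>
      using sep[of "\<lambda>e. a' e - b e"] A_diff a' bA L_A that
      by (simp add: left_diff_distrib sum_subtractf)
    obtain \<psi> where \<psi>: "\<psi> \<in> \<Psi>" "(\<Sum>e\<in>E. a' e * \<psi> e) \<noteq> 0"
      using sep[of a'] a' L_A xa x(2) by blast
    have "(\<Sum>e\<in>E. a' e * \<psi> e) \<in> L" using a' \<Psi>(2) \<psi>(1) by (intro L_sum L_mult) auto
    moreover have "C (\<Sum>e\<in>E. a' e * \<psi> e) (\<Sum>e\<in>E. v e * T)"
      unfolding eq[OF \<psi>(1)] using b(1) T(2) \<psi>(1) by (intro C_sum fin_E C_mult) auto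
    ultimately have "\<delta> \<le> (\<Sum>e\<in>E. v e) * T"
      using \<delta>(2) \<psi>(2) by (metis sum_distrib_right)
    also have "(\<Sum>e\<in>E. v e) \<le> (\<Sum>e\<in>E. v e * R ^ length e)"
    proof (rule sum_mono)
      fix e assume "e \<in> E"
      then have "0 \<le> v e" using b(1) C_nonneg by blast
      moreover have "1 \<le> R ^ length e" using R_ge_1 by (rule one_le_power)
      ultimately show "v e \<le> v e * R ^ length e" by (simp add: mult_le_cancel_left1)
    qed
    finally have "\<delta> \<le> u * T" using b(3) T(1) by (smt (verit) mult_right_mono)
    then show ?thesis using T(1) by (simp add: field_simps)
  qed
  then show ?thesis using \<delta>(1) T(1) by (intro exI[of _ "\<delta> / T"]) auto
qed

lemma cost_ring_integral: "cost_ring lat rep"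
  using cost_ring_ext gap_integral by blast

end

section \<open>Noether normalization\<close>

text \<open>A cost \<open>u\<close> bounds every coefficient of a polynomial representing the
  element. By the assumption on \<open>t\<close> this polynomial is the one with coefficients in
  \<open>L\<close>, so the gap of \<open>L\<close> applies to its leading coefficient.\<close>

lemma (in cost_ring) cost_ring_transcendental:
  assumes "\<And>p. (\<And>i. coeff p i \<in> A) \<Longrightarrow> poly p t = 0 \<Longrightarrow> p = 0"
  shows "\<exists>L' C'. cost_ring L' C' \<and>
    {x. \<exists>u. C' x u} = {poly p t | p. \<forall>i. coeff p i \<in> A}"
proof -
  interpret ext: cost_ring_extension L C "{t}" 1 1
    by unfold_locales (auto simp: one_L)
  have rep: "\<exists>p. x = poly p t \<and> (\<forall>i. C (coeff p i) u)" if "ext.rep x u" for x u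
    using that
  proof (induction rule: ext.rep.induct)
    case (base x u)
    then have "C 0 u" using C_0 C_mono C_nonneg by blast
    with base show ?case by (intro exI[of _ "[:x:]"]) (auto simp: coeff_pCons split: nat.split)
  next
    case (gen x u y)
    then obtain p where p: "x = poly p t" "\<forall>i. C (coeff p i) u" by blast
    then have "C 0 u" using C_0 C_mono C_nonneg by blast
    with p gen(2) show ?case by (intro exI[of _ "pCons 0 p"]) (auto simp: coeff_pCons split: nat.split)
  next
    case (add x u x' u')
    then obtain p p' where "x = poly p t" "\<forall>i. C (coeff p i) u" "x' = poly p' t" "\<forall>i. C (coeff p' i) u'"
      by blast
    then show ?case by (intro exI[of _ "p + p'"]) (auto simp: C_add)
  next
    case (mono x u v)
    then show ?case using C_mono by blast
  qed
  have lat: "\<exists>p. x = poly p t \<and> (\<forall>i. coeff p i \<in> L)" if "x \<in> ext.lat" for x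
    using that
  proof (induction rule: ext.lat.induct)
    case (lat_base x)
    then show ?case by (intro exI[of _ "[:x:]"]) (auto simp: coeff_pCons zero_L split: nat.split)
  next
    case (lat_gen x y)
    then obtain p where p: "x = poly p t" "\<forall>i. coeff p i \<in> L" by blast
    with lat_gen(2) show ?case
      by (intro exI[of _ "pCons 0 p"]) (auto simp: coeff_pCons zero_L split: nat.split)
  next
    case (lat_add x x')
    then obtain p p' where "x = poly p t" "\<forall>i. coeff p i \<in> L" "x' = poly p' t" "\<forall>i. coeff p' i \<in> L"
      by blast
    then show ?case by (intro exI[of _ "p + p'"]) (auto simp: L_add)
  qed
  obtain \<delta> where \<delta>: "\<delta> > 0" "\<And>x u. x \<in> L \<Longrightarrow> x \<noteq> 0 \<Longrightarrow> C x u \<Longrightarrow> \<delta> \<le> u" using gap by blast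
  have "\<delta> \<le> u" if x: "x \<in> ext.lat" "x \<noteq> 0" "ext.rep x u" for x u
  proof -
    obtain p p' where p: "x = poly p t" "\<And>i. C (coeff p i) u" "x = poly p' t" "\<And>i. coeff p' i \<in> L"
      using rep[OF x(3)] lat[OF x(1)] by blast
    have "coeff p i \<in> A" for i unfolding A_def using p(2) by blast
    then have "coeff (p' - p) i \<in> A" for i using A_diff[OF L_A[OF p(4)]] by simp
    moreover have "poly (p' - p) t = 0" using p by simp
    ultimately have "p' - p = 0" by (rule assms)
    then have "p' = p" by simp
    moreover have "p' \<noteq> 0" using p x(2) by auto
    ultimately show ?thesis using \<delta>(2)[of "lead_coeff p'" u] p(2,4) by simp
  qed
  then have "cost_ring ext.lat ext.rep" using \<delta>(1) by (intro ext.cost_ring_ext) blast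
  moreover have "{x. \<exists>u. ext.rep x u} = {poly p t | p. \<forall>i. coeff p i \<in> A}"
  proof (intro equalityI subsetI)
    fix x assume "x \<in> {x. \<exists>u. ext.rep x u}"
    then show "x \<in> {poly p t | p. \<forall>i. coeff p i \<in> A}" using rep unfolding A_def by blast
  next
    fix x assume "x \<in> {poly p t | p. \<forall>i. coeff p i \<in> A}"
    then obtain p where p: "x = poly p t" "\<forall>i. coeff p i \<in> A" by blast
    have "\<exists>u. ext.rep (poly p t) u" using p(2)
    proof (induction p)
      case 0
      show ?case using ext.base[OF C_0] by auto
    next
      case (pCons a p)
      have "coeff p i \<in> A" for i using pCons.prems[rule_format, of "Suc i"] by simp
      then obtain u where u: "ext.rep (poly p t) u" using pCons.IH by blast
      obtain v where v: "C a v" using pCons.prems[rule_format, of 0] unfolding A_def by auto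
      have "ext.rep (a + t * poly p t) (v + 1 * u)"
        by (intro ext.add[OF ext.base[OF v]] ext.gen[OF u]) simp
      then show ?case by auto
    qed
    then show "x \<in> {x. \<exists>u. ext.rep x u}" using p by simp
  qed
  ultimately show ?thesis by blast
qed

text \<open>A rational leading coefficient can be divided out without leaving \<open>A\<close>,
  which turns \<open>P\<close> into a monic equation for \<open>x\<close>.\<close>

lemma (in cost_ring) cost_ring_integral_element:
  assumes "degree P \<ge> 1" "lead_coeff P \<in> \<rat>" "\<And>i. coeff P i \<in> A" "poly P x = 0"
  shows "\<exists>L' C'. cost_ring L' C' \<and> (\<forall>y\<in>insert x A. \<exists>u. C' y u)"
proof -
  define e where "e = degree P"
  define b where "b = (\<lambda>i. - (coeff P i / lead_coeff P))"
  obtain r where r: "lead_coeff P = of_rat r" using assms(2) Rats_cases by blast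
  have lc: "lead_coeff P \<noteq> 0" using assms(1) by auto
  have bA: "b i \<in> A" for i
  proof -
    have "of_rat (- inverse r) * coeff P i \<in> A" by (intro A_mult A_rat assms)
    then show ?thesis by (simp add: b_def r of_rat_minus of_rat_inverse divide_inverse mult.commute)
  qed
  have "poly P x = (\<Sum>i<e. coeff P i * x ^ i) + lead_coeff P * x ^ e"
    unfolding poly_altdef e_def by (simp flip: lessThan_Suc_atMost)
  then have "lead_coeff P * x ^ e = - (\<Sum>i<e. coeff P i * x ^ i)"
    using assms(4) by (simp add: eq_neg_iff_add_eq_0 add.commute)
  then have "x ^ e = - (\<Sum>i<e. coeff P i * x ^ i) / lead_coeff P"
    using lc by (simp add: field_simps)
  then have xe: "x ^ e = (\<Sum>i<e. b i * x ^ i)"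
    by (simp add: b_def sum_divide_distrib sum_negf)
  have "finite (b ` {..<e})" "b ` {..<e} \<subseteq> A" using bA by auto
  then obtain q where q: "q \<in> L" "q \<noteq> 0" "\<And>y. y \<in> b ` {..<e} \<Longrightarrow> q * y \<in> L"
    using common_clear by metis
  have "finite (b ` {..<e})" "b ` {..<e} \<subseteq> A" using bA by auto
  then obtain T where T: "T \<ge> 1" "\<And>y. y \<in> b ` {..<e} \<Longrightarrow> C y T"
    using common_cost by metis
  \<comment> \<open>Large enough that the right-hand side of \<open>xe\<close>, \<open>e\<close>
    terms of cost at most \<open>T * R ^ (e - 1)\<close>, costs no more than
    \<open>R ^ e\<close>.\<close>
  define R where "R = 1 + real e * T"
  have R: "R \<ge> 1" using T by (simp add: R_def)
  interpret ext: cost_ring_extension L C "{x}" q R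
    by unfold_locales (use q R in auto)
  have "ext.comb (e - 1) e (x ^ e) (real e * T * R ^ (e - 1))"
    unfolding xe using q T by (intro ext.comb_poly) auto
  moreover have "real e * T * R ^ (e - 1) \<le> R * R ^ (e - 1)"
    using R by (intro mult_right_mono) (auto simp: R_def)
  moreover have "R * R ^ (e - 1) = R ^ e" using assms(1) e_def by (simp flip: power_Suc)
  ultimately have "ext.comb (e - 1) e (x ^ e) (R ^ e)" using ext.comb_mono by metis
  then interpret ext: integral_extension L C "{x}" q R "\<lambda>_. e"
    by unfold_locales (use assms(1) e_def in auto)
  show ?thesis
  proof (intro exI conjI)
    show "cost_ring ext.lat ext.rep" by (rule ext.cost_ring_integral)
    show "\<forall>y\<in>insert x A. \<exists>u. ext.rep y u"
      using ext.rep_gen_1 ext.base unfolding A_def by blast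
  qed
qed

lemma cost_ring_rat: "\<exists>L C. cost_ring L C \<and> {x. \<exists>u. C x u} = \<rat>"
proof (intro exI conjI)
  show "cost_ring \<int> (\<lambda>x u. x \<in> \<rat> \<and> norm x \<le> u)"
  proof
    show "of_rat a \<in> \<rat> \<and> norm (of_rat a :: complex) \<le> \<bar>of_rat a\<bar>" for a
    proof -
      have "norm (of_rat a :: complex) = \<bar>of_rat a\<bar>"
        by (cases a) (simp add: of_rat_rat norm_divide)
      then show ?thesis by simp
    qed
    show "\<exists>q\<in>\<int>. q \<noteq> 0 \<and> q * x \<in> \<int>" if "x \<in> \<rat> \<and> norm x \<le> u" for x :: complex and u
    proof -
      from that have "x \<in> \<rat>" by simp
      then obtain r where "x = of_rat r" by (rule Rats_cases)
      then obtain a b where "b > 0" "x = of_int a / of_int b"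
        by (cases r) (auto simp: of_rat_rat)
      then show ?thesis by (intro bexI[of _ "of_int b"]) auto
    qed
    show "\<exists>\<delta>>0. \<forall>x\<in>\<int>. x \<noteq> 0 \<longrightarrow> (\<forall>u. x \<in> \<rat> \<and> norm (x :: complex) \<le> u \<longrightarrow> \<delta> \<le> u)"
    proof (intro exI[of _ 1] conjI ballI impI allI)
      fix x :: complex and u :: real
      assume x: "x \<in> \<int>" "x \<noteq> 0" "x \<in> \<rat> \<and> norm x \<le> u"
      from x(1) obtain k where "x = of_int k" by (rule Ints_cases)
      with x have "1 \<le> norm x" by simp
      with x show "1 \<le> u" by simp
    qed simp
    show "x + y \<in> \<rat> \<and> norm (x + y) \<le> u + v" if "x \<in> \<rat> \<and> norm x \<le> u" "y \<in> \<rat> \<and> norm y \<le> v"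
      for x y :: complex and u v
      using that by (auto intro: norm_triangle_le)
    show "x * y \<in> \<rat> \<and> norm (x * y) \<le> u * v" if "x \<in> \<rat> \<and> norm x \<le> u" "y \<in> \<rat> \<and> norm y \<le> v"
      for x y :: complex and u v
      using that by (auto simp: norm_mult intro!: mult_mono order_trans[OF norm_ge_zero])
    show "\<exists>u. x \<in> \<rat> \<and> norm x \<le> u" if "x \<in> \<int>" for x :: complex
      using that Ints_subset_Rats by auto
    show "0 \<le> u" if "x \<in> \<rat> \<and> norm x \<le> u" for x :: complex and u
      using that norm_ge_zero[of x] by linarith
  qed auto
qed auto

text \<open>The ring of polynomial expressions over the rationals in the listed numbers, nested so
  that the head of the list is the last one adjoined.\<close>

primrec qpolys :: "complex list \<Rightarrow> complex set" where
  "qpolys [] = \<rat>"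
| "qpolys (v # vs) = {poly p v | p. \<forall>i. coeff p i \<in> qpolys vs}"

definition rat_algebra :: "complex set \<Rightarrow> bool" where
  "rat_algebra S \<longleftrightarrow> \<rat> \<subseteq> S \<and> (\<forall>x\<in>S. \<forall>y\<in>S. x + y \<in> S \<and> x * y \<in> S)"

definition poly_over :: "complex set \<Rightarrow> complex poly \<Rightarrow> bool" where
  "poly_over S p \<longleftrightarrow> (\<forall>i. coeff p i \<in> S)"

context
  fixes S assumes S: "rat_algebra S"
begin

lemma alg_0: "0 \<in> S" and alg_1: "1 \<in> S"
  using S unfolding rat_algebra_def by auto

lemma alg_add: "x \<in> S \<Longrightarrow> y \<in> S \<Longrightarrow> x + y \<in> S"
  and alg_mult: "x \<in> S \<Longrightarrow> y \<in> S \<Longrightarrow> x * y \<in> S"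
  using S unfolding rat_algebra_def by auto

lemma alg_sum: "(\<And>i. i \<in> I \<Longrightarrow> h i \<in> S) \<Longrightarrow> sum h I \<in> S"
  by (induction I rule: infinite_finite_induct) (auto simp: alg_0 alg_add)

lemma poly_over_const: "x \<in> S \<Longrightarrow> poly_over S [:x:]"
  unfolding poly_over_def by (auto simp: coeff_pCons alg_0 split: nat.split)

lemma poly_over_monom: "x \<in> S \<Longrightarrow> poly_over S (monom x n)"
  unfolding poly_over_def by (auto simp: alg_0)

lemma poly_over_add: "poly_over S p \<Longrightarrow> poly_over S p' \<Longrightarrow> poly_over S (p + p')"
  unfolding poly_over_def by (auto simp: alg_add)

lemma poly_over_mult: "poly_over S p \<Longrightarrow> poly_over S p' \<Longrightarrow> poly_over S (p * p')"
  unfolding poly_over_def by (auto simp: coeff_mult intro!: alg_sum alg_mult)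

lemma poly_over_power: "poly_over S p \<Longrightarrow> poly_over S (p ^ n)"
  by (induction n) (auto simp: poly_over_mult poly_over_const alg_1 one_pCons)

lemma poly_over_sum: "(\<And>i. i \<in> I \<Longrightarrow> poly_over S (h i)) \<Longrightarrow> poly_over S (sum h I)"
proof (induction I rule: infinite_finite_induct)
  case (insert x I)
  then show ?case by (simp add: poly_over_add)
qed (auto simp: poly_over_def alg_0)

lemma rat_algebra_poly_image: "rat_algebra {poly p v | p. poly_over S p}"
  unfolding rat_algebra_def
proof (intro conjI subsetI ballI)
  fix x :: complex assume "x \<in> \<rat>"
  then have "x \<in> S" using S unfolding rat_algebra_def by blast
  then show "x \<in> {poly p v | p. poly_over S p}" using poly_over_const[of x] by force
next
  fix x y assume "x \<in> {poly p v | p. poly_over S p}" "y \<in> {poly p v | p. poly_over S p}"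
  then obtain p p' where p: "x = poly p v" "poly_over S p" "y = poly p' v" "poly_over S p'" by blast
  show "x + y \<in> {poly p v | p. poly_over S p}"
    using poly_over_add[OF p(2,4)] p(1,3) by force
  show "x * y \<in> {poly p v | p. poly_over S p}"
    using poly_over_mult[OF p(2,4)] p(1,3) by force
qed

lemma poly_in_alg: "poly_over S p \<Longrightarrow> v \<in> S \<Longrightarrow> poly p v \<in> S"
proof (induction p)
  case 0
  then show ?case by (simp add: alg_0)
next
  case (pCons a p)
  have "a \<in> S" "poly_over S p"
    using pCons.prems(1)[unfolded poly_over_def, THEN spec, of 0] pCons.prems(1)[unfolded poly_over_def, THEN spec, of "Suc _"]
    by (auto simp: poly_over_def)
  then show ?case using pCons by (simp add: alg_add alg_mult)
qed

end

lemma qpolys_Cons: "qpolys (v # vs) = {poly p v | p. poly_over (qpolys vs) p}"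
  by (simp add: poly_over_def)

lemma rat_algebra_qpolys: "rat_algebra (qpolys vs)"
proof (induction vs)
  case Nil
  show ?case by (auto simp: rat_algebra_def)
next
  case (Cons v vs)
  then show ?case unfolding qpolys_Cons by (rule rat_algebra_poly_image)
qed

lemma qpolys_mono: "x \<in> qpolys vs \<Longrightarrow> x \<in> qpolys (v # vs)"
  unfolding qpolys_Cons using poly_over_const[OF rat_algebra_qpolys, of x vs] by force

lemma qpolys_var: "v \<in> qpolys (v # vs)"
  unfolding qpolys_Cons
  using poly_over_monom[OF rat_algebra_qpolys alg_1[OF rat_algebra_qpolys], of vs 1]
  by (auto simp: poly_monom intro!: exI[of _ "monom 1 1"])

lemma qpolys_subset: "rat_algebra S \<Longrightarrow> set vs \<subseteq> S \<Longrightarrow> qpolys vs \<subseteq> S"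
proof (induction vs)
  case Nil
  then show ?case by (simp add: rat_algebra_def)
next
  case (Cons v vs)
  then have "qpolys vs \<subseteq> S" by simp
  then have "poly_over S p" if "poly_over (qpolys vs) p" for p
    using that unfolding poly_over_def by blast
  then show ?case unfolding qpolys_Cons using poly_in_alg[OF Cons.prems(1)] Cons.prems(2) by auto
qed

lemma lead_coeff_sum_distinct_degrees:
  fixes F :: "'a \<Rightarrow> complex poly"
  assumes "finite I" "I \<noteq> {}" "inj_on (\<lambda>i. degree (F i)) I" "\<And>i. i \<in> I \<Longrightarrow> F i \<noteq> 0"
  shows "\<exists>i\<in>I. degree (sum F I) = degree (F i) \<and> lead_coeff (sum F I) = lead_coeff (F i)"
  using assms
proof (induction I rule: finite_ne_induct)
  case (singleton x)
  then show ?case by simp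
next
  case (insert j I)
  have "inj_on (\<lambda>i. degree (F i)) I" using insert.prems(1) by (rule inj_on_subset) auto
  from insert.IH[OF this] insert.prems(2) obtain i where i: "i \<in> I"
    "degree (sum F I) = degree (F i)" "lead_coeff (sum F I) = lead_coeff (F i)" by blast
  have ne: "degree (F j) \<noteq> degree (F i)"
    using insert.prems(1) insert.hyps i(1) by (auto simp: inj_on_def)
  have s: "sum F (insert j I) = F j + sum F I" using insert.hyps by simp
  show ?case
  proof (cases "degree (F j) < degree (sum F I)")
    case True
    then show ?thesis unfolding s using i
      degree_add_eq_right[OF True] lead_coeff_add_le[OF True] by (metis insertI2)
  next
    case False
    then have "degree (sum F I) < degree (F j)" using ne i by simp
    then show ?thesis unfolding s add.commute[of "F j"]
      using degree_add_eq_right lead_coeff_add_le by (metis insertI1)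
  qed
qed

text \<open>If \<open>x\<close> is algebraic, an element has many expressions in powers of
  \<open>x\<close>, so degree and leading coefficient are recorded for a chosen \<open>P\<close> and
  not for \<open>z\<close>.\<close>

definition dominated :: "complex set \<Rightarrow> complex \<Rightarrow> nat \<Rightarrow> complex \<Rightarrow> complex poly \<Rightarrow> bool" where
  "dominated S x M z P \<longleftrightarrow> poly_over S P \<and> P \<noteq> 0 \<and> lead_coeff P \<in> \<rat> \<and> poly P x = z \<and> M dvd degree P"

text \<open>Noether's substitution \<open>v = v' + x ^ m\<close> with rapidly growing exponents makes every nonzero
  polynomial expression in the \<open>v\<close>s a polynomial in \<open>x\<close> with rational leading coefficient. The
  divisibility of the degree by \<open>M\<close> keeps different terms apart in the induction.\<close>

lemma noether_substitution:
  assumes "M \<ge> 1" "finite Z" "Z \<subseteq> qpolys vs"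
  shows "\<exists>vs'. length vs' = length vs \<and> (\<forall>v\<in>set vs. \<exists>v'\<in>set vs'. \<exists>m. v = v' + x ^ m) \<and>
    (\<forall>z\<in>Z. z \<noteq> 0 \<longrightarrow> (\<exists>P. dominated (qpolys vs') x M z P))"
  using assms(2,3)
proof (induction vs arbitrary: Z)
  case Nil
  then have "dominated (qpolys []) x M z [:z:]" if "z \<in> Z" "z \<noteq> 0" for z
    using that by (auto simp: dominated_def poly_over_const[OF rat_algebra_qpolys[of "[]", simplified]])
  then show ?case by (intro exI[of _ "[]"]) auto
next
  case (Cons v ws)
  have "\<forall>z\<in>Z. \<exists>p. poly_over (qpolys ws) p \<and> z = poly p v"
    using Cons.prems(2) unfolding qpolys_Cons by blast
  then obtain p where p: "\<And>z. z \<in> Z \<Longrightarrow> poly_over (qpolys ws) (p z)" "\<And>z. z \<in> Z \<Longrightarrow> z = poly (p z) v"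
    by metis
  define Z' where "Z' = (\<Union>z\<in>Z. coeff (p z) ` {..degree (p z)})"
  have Z': "finite Z'" "Z' \<subseteq> qpolys ws"
    using Cons.prems(1) p(1) unfolding Z'_def poly_over_def by auto
  from Cons.IH[OF this] obtain ws' where ws': "length ws' = length ws"
    "\<forall>v\<in>set ws. \<exists>v'\<in>set ws'. \<exists>m. v = v' + x ^ m"
    "\<forall>z\<in>Z'. z \<noteq> 0 \<longrightarrow> (\<exists>P. dominated (qpolys ws') x M z P)" by blast
  then obtain P where P: "\<And>z. z \<in> Z' \<Longrightarrow> z \<noteq> 0 \<Longrightarrow> dominated (qpolys ws') x M z (P z)" by metis
  \<comment> \<open>Exceeds all degrees that occur, so that \<open>j\<close> can be read off from
    the degree of the \<open>j\<close>-th term by division by \<open>m\<close>; being a multiple of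
    \<open>M\<close>, it keeps these degrees divisible by \<open>M\<close>.\<close>
  define m where "m = M * Suc (\<Sum>z\<in>Z'. degree (P z))"
  have m: "degree (P z) < m" if "z \<in> Z'" for z
  proof -
    have "degree (P z) \<le> (\<Sum>z\<in>Z'. degree (P z))"
      using Z'(1) that by (intro member_le_sum) auto
    then have "degree (P z) < Suc (\<Sum>z\<in>Z'. degree (P z))" by simp
    also have "\<dots> \<le> m" unfolding m_def using mult_le_mono1[OF assms(1)] by (metis mult_1)
    finally show ?thesis .
  qed
  define v' where "v' = v - x ^ m"
  have alg: "rat_algebra (qpolys (v' # ws'))" by (rule rat_algebra_qpolys)
  \<comment> \<open>The substitution itself: \<open>v\<close> as a monic polynomial in
    \<open>x\<close> of degree \<open>m\<close>.\<close>
  define B where "B = monom 1 m + [:v':]"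
  have Bdeg: "degree B = m" "lead_coeff B = 1"
  proof -
    have "m > 0" using assms(1) by (simp add: m_def)
    then show "degree B = m" unfolding B_def by (subst degree_add_eq_left) (auto simp: degree_monom_eq)
    then show "lead_coeff B = 1" using \<open>m > 0\<close> by (simp add: B_def coeff_pCons split: nat.split)
  qed
  have Bover: "poly_over (qpolys (v' # ws')) B"
    unfolding B_def by (intro poly_over_add[OF alg] poly_over_monom[OF alg] poly_over_const[OF alg]
        alg_1[OF alg] qpolys_var)
  have Bx: "poly B x = v" by (simp add: B_def v'_def poly_monom)
  have "\<exists>Q. dominated (qpolys (v' # ws')) x M z Q" if z: "z \<in> Z" "z \<noteq> 0" for z
  proof -
    define I where "I = {j. j \<le> degree (p z) \<and> coeff (p z) j \<noteq> 0}"
    define F where "F = (\<lambda>j. P (coeff (p z) j) * B ^ j)"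
    have I: "finite I" unfolding I_def by simp
    have "p z \<noteq> 0" using p(2)[OF z(1)] z(2) by auto
    then have "degree (p z) \<in> I" unfolding I_def by simp
    then have I_ne: "I \<noteq> {}" by blast
    have c: "coeff (p z) j \<in> Z'" "coeff (p z) j \<noteq> 0" if "j \<in> I" for j
      using that z unfolding I_def Z'_def by auto
    note d = P[OF c, unfolded dominated_def]
    have B_ne: "B \<noteq> 0" using Bdeg by auto
    have Fdeg: "degree (F j) = degree (P (coeff (p z) j)) + m * j" if "j \<in> I" for j
      unfolding F_def using d[OF that that] B_ne Bdeg(1) by (simp add: degree_mult_eq degree_power_eq mult.commute)
    have F_ne: "F j \<noteq> 0" if "j \<in> I" for j
      unfolding F_def using d[OF that that] B_ne by simp
    have Flc: "lead_coeff (F j) \<in> \<rat>" if "j \<in> I" for j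
      unfolding F_def using d[OF that that] Bdeg(2) by (simp add: lead_coeff_mult lead_coeff_power)
    have "degree (F j) div m = j" if "j \<in> I" for j
      unfolding Fdeg[OF that] using m[OF c(1)[OF that]] by simp
    then have "inj_on (\<lambda>j. degree (F j)) I" by (intro inj_onI) metis
    from lead_coeff_sum_distinct_degrees[OF I I_ne this F_ne] obtain i where i: "i \<in> I"
      "degree (sum F I) = degree (F i)" "lead_coeff (sum F I) = lead_coeff (F i)" by blast
    have "sum F I \<noteq> 0" using i F_ne[OF i(1)] by (metis leading_coeff_0_iff)
    moreover have "poly_over (qpolys (v' # ws')) (F j)" if "j \<in> I" for j
    proof -
      have "poly_over (qpolys (v' # ws')) (P (coeff (p z) j))"
        using d[OF that that] qpolys_mono unfolding poly_over_def by blast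
      then show ?thesis unfolding F_def by (intro poly_over_mult[OF alg] poly_over_power[OF alg] Bover)
    qed
    then have "poly_over (qpolys (v' # ws')) (sum F I)" by (rule poly_over_sum[OF alg])
    moreover have "poly (sum F I) x = z"
    proof -
      have "poly (sum F I) x = (\<Sum>j\<in>I. coeff (p z) j * v ^ j)"
        unfolding poly_sum F_def using d by (intro sum.cong) (auto simp: Bx)
      also have "\<dots> = (\<Sum>j\<le>degree (p z). coeff (p z) j * v ^ j)"
        unfolding I_def by (intro sum.mono_neutral_left) auto
      also have "\<dots> = z" using p(2)[OF z(1)] by (simp add: poly_altdef)
      finally show ?thesis .
    qed
    moreover have "M dvd degree (F i)"
      unfolding Fdeg[OF i(1)] using d[OF i(1) i(1)] by (auto simp: m_def)
    ultimately show ?thesis unfolding dominated_def using i Flc[OF i(1)] by metis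
  qed
  moreover have "\<forall>u\<in>set (v # ws). \<exists>v''\<in>set (v' # ws'). \<exists>m. u = v'' + x ^ m"
  proof
    fix u assume "u \<in> set (v # ws)"
    then show "\<exists>v''\<in>set (v' # ws'). \<exists>m. u = v'' + x ^ m"
      using ws'(2) v'_def by (cases "u = v") (auto intro: exI[of _ m])
  qed
  ultimately show ?case using ws'(1) by (intro exI[of _ "v' # ws'"]) auto
qed

text \<open>Each coefficient of the relation \<open>p\<close> is replaced by a polynomial in
  \<open>x\<close> with degree divisible by \<open>M > degree p\<close>. The term with
  \<open>x ^ j\<close> then has degree \<open>j\<close> modulo \<open>M\<close>, so the top term
  cannot cancel and its leading coefficient is rational.\<close>

lemma noether_normalization:
  assumes "p \<noteq> 0" "poly_over (qpolys vs) p" "poly p x = 0"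
  shows "\<exists>vs' P. length vs' = length vs \<and> (\<forall>v\<in>set vs. \<exists>v'\<in>set vs'. \<exists>m. v = v' + x ^ m) \<and>
    poly_over (qpolys vs') P \<and> degree P \<ge> 1 \<and> lead_coeff P \<in> \<rat> \<and> poly P x = 0"
proof -
  define M where "M = Suc (degree p)"
  have "coeff p ` {..degree p} \<subseteq> qpolys vs" using assms(2) by (auto simp: poly_over_def)
  then obtain vs' where vs': "length vs' = length vs" "\<forall>v\<in>set vs. \<exists>v'\<in>set vs'. \<exists>m. v = v' + x ^ m"
    "\<forall>z\<in>coeff p ` {..degree p}. z \<noteq> 0 \<longrightarrow> (\<exists>P. dominated (qpolys vs') x M z P)"
    using noether_substitution[of M "coeff p ` {..degree p}" vs x] by (auto simp: M_def)
  then obtain P where P: "\<And>z. z \<in> coeff p ` {..degree p} \<Longrightarrow> z \<noteq> 0 \<Longrightarrow> dominated (qpolys vs') x M z (P z)"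
    by metis
  have alg: "rat_algebra (qpolys vs')" by (rule rat_algebra_qpolys)
  define I where "I = {j. j \<le> degree p \<and> coeff p j \<noteq> 0}"
  define F where "F = (\<lambda>j. P (coeff p j) * monom 1 j)"
  have I: "finite I" unfolding I_def by simp
  have "degree p \<in> I" unfolding I_def using assms(1) by simp
  then have I_ne: "I \<noteq> {}" by blast
  have d: "dominated (qpolys vs') x M (coeff p j) (P (coeff p j))" if "j \<in> I" for j
    using P that unfolding I_def by auto
  note d = d[unfolded dominated_def]
  have Fdeg: "degree (F j) = degree (P (coeff p j)) + j" if "j \<in> I" for j
    unfolding F_def using d[OF that] by (simp add: degree_mult_eq degree_monom_eq monom_eq_0_iff)
  have F_ne: "F j \<noteq> 0" if "j \<in> I" for j
    unfolding F_def using d[OF that] by (simp add: monom_eq_0_iff)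
  have Flc: "lead_coeff (F j) \<in> \<rat>" if "j \<in> I" for j
    unfolding F_def using d[OF that] by (simp add: lead_coeff_mult lead_coeff_monom)
  have "degree (F j) mod M = j" if "j \<in> I" for j
  proof -
    have "j < M" using that by (auto simp: I_def M_def)
    moreover have "M dvd degree (P (coeff p j))" using d[OF that] by blast
    ultimately show ?thesis unfolding Fdeg[OF that] by (auto elim!: dvdE)
  qed
  then have "inj_on (\<lambda>j. degree (F j)) I" by (intro inj_onI) metis
  from lead_coeff_sum_distinct_degrees[OF I I_ne this F_ne] obtain i where i: "i \<in> I"
    "degree (sum F I) = degree (F i)" "lead_coeff (sum F I) = lead_coeff (F i)" by blast
  have ne: "sum F I \<noteq> 0" using i F_ne[OF i(1)] by (metis leading_coeff_0_iff)
  have "poly_over (qpolys vs') (F j)" if "j \<in> I" for j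
    unfolding F_def using d[OF that] by (intro poly_over_mult[OF alg] poly_over_monom[OF alg] alg_1[OF alg]) auto
  then have over: "poly_over (qpolys vs') (sum F I)" by (rule poly_over_sum[OF alg])
  have zero: "poly (sum F I) x = 0"
  proof -
    have "poly (sum F I) x = (\<Sum>j\<in>I. coeff p j * x ^ j)"
      unfolding poly_sum F_def using d by (intro sum.cong) (auto simp: poly_monom)
    also have "\<dots> = (\<Sum>j\<le>degree p. coeff p j * x ^ j)"
      unfolding I_def by (intro sum.mono_neutral_left) auto
    also have "\<dots> = 0" using assms(3) by (simp add: poly_altdef)
    finally show ?thesis .
  qed
  have "degree (sum F I) \<ge> 1"
  proof (rule ccontr)
    assume "\<not> ?thesis"
    then obtain c where "sum F I = [:c:]" using degree_eq_zeroE by (metis less_one not_le)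
    with zero ne show False by simp
  qed
  then show ?thesis using vs'(1,2) over zero i(3) Flc[OF i(1)] by metis
qed

text \<open>The elements are adjoined from the end of the list while each is transcendental over its
  successors. At an algebraic \<open>v\<close>, normalization trades the successors
  \<open>vs\<close> for as many \<open>vs'\<close> over which \<open>v\<close> is integral. The
  shorter list \<open>us @ vs'\<close> is handled by induction, \<open>v\<close> is adjoined, and
  \<open>vs\<close> is recovered from \<open>vs'\<close> and powers of \<open>v\<close>.\<close>

theorem cost_ring_exists: "\<exists>L C. cost_ring L C \<and> (\<forall>x\<in>set xs. \<exists>u. C x u)"
proof (induction "length xs" arbitrary: xs rule: less_induct)
  case less
  \<comment> \<open>Equality with \<open>qpolys vs\<close>, not just inclusion, makes the next case
    distinction one about relations over \<open>qpolys vs\<close>, to which normalization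
    applies.\<close>
  have "(\<exists>L C. cost_ring L C \<and> {x. \<exists>u. C x u} = qpolys vs) \<or>
      (\<exists>L C. cost_ring L C \<and> (\<forall>x\<in>set xs. \<exists>u. C x u))" if "xs = us @ vs" for us vs
    using that
  proof (induction vs arbitrary: us)
    case Nil
    show ?case using cost_ring_rat by simp
  next
    case (Cons v vs)
    have "xs = (us @ [v]) @ vs" using Cons.prems by simp
    from Cons.IH[OF this] show ?case
    proof
      assume "\<exists>L C. cost_ring L C \<and> {x. \<exists>u. C x u} = qpolys vs"
      then obtain L C where LC: "cost_ring L C" "{x. \<exists>u. C x u} = qpolys vs" by blast
      interpret cost_ring L C by fact
      have A: "A = qpolys vs" unfolding A_def by (rule LC(2))
      show ?thesis
      proof (cases "\<exists>p. p \<noteq> 0 \<and> poly_over (qpolys vs) p \<and> poly p v = 0")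
        case False
        then have "\<exists>L' C'. cost_ring L' C' \<and> {x. \<exists>u. C' x u} = {poly p v | p. \<forall>i. coeff p i \<in> A}"
          using A by (intro cost_ring_transcendental) (auto simp: poly_over_def)
        then show ?thesis unfolding A by simp
      next
        case True
        then obtain vs' P where P: "length vs' = length vs" "\<forall>v'\<in>set vs. \<exists>w\<in>set vs'. \<exists>m. v' = w + v ^ m"
          "poly_over (qpolys vs') P" "degree P \<ge> 1" "lead_coeff P \<in> \<rat>" "poly P v = 0"
          using noether_normalization by blast
        have "length (us @ vs') < length xs" using P(1) Cons.prems by simp
        from less[OF this] obtain L C where LC: "cost_ring L C" "\<forall>x\<in>set (us @ vs'). \<exists>u. C x u" by blast
        interpret r: cost_ring L C by fact
        have "rat_algebra r.A"
          unfolding rat_algebra_def using r.A_rat r.A_add r.A_mult by (auto elim: Rats_cases)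
        moreover have sub: "set us \<subseteq> r.A" "set vs' \<subseteq> r.A" using LC(2) unfolding r.A_def by auto
        ultimately have "qpolys vs' \<subseteq> r.A" using qpolys_subset by blast
        then have "coeff P i \<in> r.A" for i using P(3) unfolding poly_over_def by blast
        from r.cost_ring_integral_element[OF P(4,5) this P(6)] obtain L' C' where
          LC': "cost_ring L' C'" "\<forall>y\<in>insert v r.A. \<exists>u. C' y u" by blast
        interpret r': cost_ring L' C' by fact
        have vA: "v \<in> r'.A" and sub': "r.A \<subseteq> r'.A" using LC'(2) unfolding r'.A_def by auto
        have pw: "v ^ m \<in> r'.A" for m
          by (induction m) (auto simp: r'.A_1 r'.A_mult vA)
        have "set vs \<subseteq> r'.A"
        proof
          fix y assume "y \<in> set vs"
          then obtain w m where "w \<in> set vs'" "y = w + v ^ m" using P(2) by blast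
          with sub(2) sub' show "y \<in> r'.A" using r'.A_add[OF _ pw] by auto
        qed
        then have "set xs \<subseteq> r'.A" using Cons.prems sub(1) sub' vA by auto
        then have "\<forall>x\<in>set xs. \<exists>u. C' x u" unfolding r'.A_def by blast
        with LC'(1) show ?thesis by blast
      qed
    qed simp
  qed
  from this[of "[]" xs] show ?case
  proof
    assume "\<exists>L C. cost_ring L C \<and> {x. \<exists>u. C x u} = qpolys xs"
    then obtain L C where LC: "cost_ring L C" "{x. \<exists>u. C x u} = qpolys xs" by blast
    have "x \<in> qpolys xs" if "x \<in> set xs" for x
      using that by (induction xs) (use qpolys_var qpolys_mono in auto)
    with LC show ?thesis by blast
  qed simp
qed

section \<open>Orbits as polynomials in the parameter\<close>

primrec orbit_poly :: "complex poly \<Rightarrow> complex poly \<Rightarrow> nat \<Rightarrow> complex poly" where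
  "orbit_poly f a 0 = a"
| "orbit_poly f a (Suc n) = pcompose f (orbit_poly f a n) + [:0, 1:]"

lemma poly_orbit_poly: "poly (orbit_poly f a n) x = (poly (f + [:x:]) ^^ n) (poly a x)"
  by (induction n) (auto simp: poly_pcompose)

lemma finite_orbit_poly:
  assumes "preperiodic (f + [:x:]) (poly a x)"
  shows "finite (range (\<lambda>n. poly (orbit_poly f a n) x))"
proof -
  define h where "h = poly (f + [:x:])"
  define z where "z = poly a x"
  obtain i j where ij: "i < j" "(h ^^ i) z = (h ^^ j) z"
    using assms unfolding preperiodic_def h_def z_def by (metis linorder_neqE_nat)
  have "(h ^^ n) z \<in> (\<lambda>n. (h ^^ n) z) ` {..<j}" for n
  proof (induction n rule: less_induct)
    case (less n)
    show ?case
    proof (cases "n < j")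
      case False
      then have n: "n = (n - j) + j" by simp
      have "(h ^^ n) z = (h ^^ (n - j)) ((h ^^ j) z)"
        by (subst n) (simp only: funpow_add o_apply)
      also have "\<dots> = (h ^^ (n - j + i)) z" by (simp only: ij(2)[symmetric] funpow_add o_apply)
      finally show ?thesis using less[of "n - j + i"] ij(1) False by simp
    qed auto
  qed
  then have "range (\<lambda>n. (h ^^ n) z) \<subseteq> (\<lambda>n. (h ^^ n) z) ` {..<j}" by blast
  then show ?thesis
    unfolding poly_orbit_poly h_def z_def by (rule finite_subset) simp
qed

lemma degree_orbit_poly:
  assumes "lead_coeff f = 1" "degree f \<ge> 2" "degree a \<ge> 1"
  shows "degree (orbit_poly f a n) = degree a * degree f ^ n \<and>
    lead_coeff (orbit_poly f a n) = lead_coeff a ^ (degree f ^ n)"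
proof (induction n)
  case (Suc n)
  let ?P = "orbit_poly f a n"
  have P: "degree ?P \<ge> 1" using Suc assms by simp
  have d: "degree (pcompose f ?P) = degree f * degree ?P" by (rule degree_pcompose)
  have "degree f * degree ?P \<ge> 2 * 1" using assms(2) P by (intro mult_le_mono)
  then have lt: "degree [:0, 1 :: complex:] < degree (pcompose f ?P)" unfolding d by simp
  have "degree (orbit_poly f a (Suc n)) = degree (pcompose f ?P)"
    using degree_add_eq_left[OF lt] by simp
  moreover have "lead_coeff (orbit_poly f a (Suc n)) = lead_coeff (pcompose f ?P)"
    using lead_coeff_add_le[OF lt] by (simp add: add.commute)
  moreover have "lead_coeff (pcompose f ?P) = lead_coeff f * lead_coeff ?P ^ degree f"
    using P by (intro lead_coeff_comp) simp
  moreover have "lead_coeff ?P ^ degree f = lead_coeff a ^ (degree f ^ Suc n)"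
    by (simp only: conjunct2[OF Suc] power_mult[symmetric] power_Suc2)
  moreover have "degree f * degree ?P = degree a * degree f ^ Suc n"
    using Suc by simp
  ultimately show ?case using assms(1) d by (metis mult_1)
qed simp

lemma pcompose_diff:
  fixes f P Q :: "complex poly"
  assumes "lead_coeff f = 1" "degree f \<ge> 1" "degree P = N" "degree Q = N" "N \<ge> 1"
    "lead_coeff P = \<kappa>" "lead_coeff Q = \<kappa>" "P \<noteq> Q"
  shows "degree (pcompose f P - pcompose f Q) = degree (P - Q) + (degree f - 1) * N \<and>
    lead_coeff (pcompose f P - pcompose f Q) = lead_coeff (P - Q) * of_nat (degree f) * \<kappa> ^ (degree f - 1)"
proof -
  define d where "d = degree f"
  \<comment> \<open>The quotient of \<open>P ^ i - Q ^ i\<close> by \<open>P - Q\<close>. For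
    \<open>i = d\<close> its summands share degree and leading coefficient, which produces the
    factor \<open>d\<close>.\<close>
  define G where "G = (\<lambda>i. \<Sum>j<i. Q ^ (i - Suc j) * P ^ j)"
  define H where "H = (\<Sum>i\<le>d. Polynomial.smult (coeff f i) (G i))"
  have d: "d \<ge> 1" "coeff f d = 1" using assms by (auto simp: d_def)
  have nz: "P \<noteq> 0" "Q \<noteq> 0" "\<kappa> \<noteq> 0" using assms by auto
  have eq: "pcompose f P - pcompose f Q = (P - Q) * H"
  proof -
    have "poly (pcompose f P - pcompose f Q) x = poly ((P - Q) * H) x" for x
    proof -
      have "poly (pcompose f P - pcompose f Q) x = (\<Sum>i\<le>d. coeff f i * (poly P x ^ i - poly Q x ^ i))"
        by (simp add: poly_pcompose poly_altdef[of f] d_def sum_subtractf right_diff_distrib)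
      also have "\<dots> = (\<Sum>i\<le>d. coeff f i * ((poly P x - poly Q x) * poly (G i) x))"
        by (simp add: power_diff_sumr2 G_def poly_sum)
      also have "\<dots> = poly ((P - Q) * H) x"
        by (simp add: H_def poly_sum sum_distrib_left mult_ac)
      finally show ?thesis .
    qed
    then show ?thesis by (simp add: poly_eq_poly_eq_iff[symmetric] fun_eq_iff)
  qed
  have t: "degree (Q ^ (i - Suc j) * P ^ j) = (i - 1) * N" "lead_coeff (Q ^ (i - Suc j) * P ^ j) = \<kappa> ^ (i - 1)"
    if "j < i" for i j
  proof -
    have "(i - Suc j) + j = i - 1" using that by simp
    moreover have "degree (Q ^ (i - Suc j) * P ^ j) = ((i - Suc j) + j) * N"
      using nz assms(3,4) by (simp add: degree_mult_eq degree_power_eq add_mult_distrib)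
    moreover have "lead_coeff (Q ^ (i - Suc j) * P ^ j) = \<kappa> ^ ((i - Suc j) + j)"
      by (simp only: lead_coeff_mult lead_coeff_power assms(6,7) power_add)
    ultimately show "degree (Q ^ (i - Suc j) * P ^ j) = (i - 1) * N"
      "lead_coeff (Q ^ (i - Suc j) * P ^ j) = \<kappa> ^ (i - 1)" by (simp_all only:)
  qed
  have degG: "degree (G i) \<le> (i - 1) * N" for i
    unfolding G_def by (intro degree_sum_le) (auto simp: t)
  have degH: "degree H \<le> (d - 1) * N"
    unfolding H_def
  proof (intro degree_sum_le)
    fix i assume "i \<in> {..d}"
    then have "(i - 1) * N \<le> (d - 1) * N" by (intro mult_le_mono) auto
    then show "degree (Polynomial.smult (coeff f i) (G i)) \<le> (d - 1) * N"
      using degG[of i] degree_smult_le[of "coeff f i" "G i"] by linarith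
  qed simp
  have "coeff H ((d - 1) * N) = (\<Sum>i\<le>d. coeff f i * coeff (G i) ((d - 1) * N))"
    by (simp add: H_def coeff_sum)
  also have "\<dots> = (\<Sum>i\<in>{d}. coeff f i * coeff (G i) ((d - 1) * N))"
  proof (intro sum.mono_neutral_right ballI)
    fix i assume i: "i \<in> {..d} - {d}"
    show "coeff f i * coeff (G i) ((d - 1) * N) = 0"
    \<comment> \<open>When \<open>d = 1\<close>, truncated subtraction gives \<open>i = 0\<close>
      the same degree bound as \<open>i = d\<close>, but \<open>G 0\<close> is an empty sum.\<close>
    proof (cases "i = 0")
      case False
      then have "(i - 1) * N < (d - 1) * N" using i assms(5) by auto
      then have "coeff (G i) ((d - 1) * N) = 0" using degG[of i] by (intro coeff_eq_0) linarith
      then show ?thesis by simp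
    qed (simp add: G_def)
  qed auto
  also have "\<dots> = (\<Sum>j<d. coeff (Q ^ (d - Suc j) * P ^ j) ((d - 1) * N))"
    using d by (simp add: G_def coeff_sum)
  also have "\<dots> = (\<Sum>j<d. \<kappa> ^ (d - 1))"
  proof (rule sum.cong)
    fix j assume "j \<in> {..<d}"
    then show "coeff (Q ^ (d - Suc j) * P ^ j) ((d - 1) * N) = \<kappa> ^ (d - 1)"
      using t[of j d] by simp
  qed simp
  finally have cH: "coeff H ((d - 1) * N) = of_nat d * \<kappa> ^ (d - 1)" by simp
  then have "coeff H ((d - 1) * N) \<noteq> 0" using d nz by simp
  then have H: "degree H = (d - 1) * N" "H \<noteq> 0" using degH le_degree by (auto intro: antisym)
  have "degree ((P - Q) * H) = degree (P - Q) + (d - 1) * N"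
    using assms(8) H by (simp add: degree_mult_eq)
  moreover have "lead_coeff ((P - Q) * H) = lead_coeff (P - Q) * (of_nat d * \<kappa> ^ (d - 1))"
    unfolding lead_coeff_mult H(1) cH ..
  ultimately show ?thesis unfolding eq d_def by (simp only: mult.assoc)
qed

lemma degree_orbit_poly_diff:
  assumes "lead_coeff f = 1" "degree f \<ge> 2" "degree a = m" "degree b = m" "m \<ge> 1"
    "lead_coeff a = \<gamma>" "lead_coeff b = \<gamma>" "a \<noteq> b"
  shows "degree (orbit_poly f a n - orbit_poly f b n) = degree (a - b) + (degree f ^ n - 1) * m \<and>
    lead_coeff (orbit_poly f a n - orbit_poly f b n) =
      lead_coeff (a - b) * of_nat (degree f) ^ n * \<gamma> ^ (degree f ^ n - 1) \<and>
    orbit_poly f a n \<noteq> orbit_poly f b n"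
proof (induction n)
  case (Suc n)
  let ?d = "degree f" and ?P = "orbit_poly f a n" and ?Q = "orbit_poly f b n"
  have P: "degree ?P = m * ?d ^ n" "degree ?Q = m * ?d ^ n"
    "lead_coeff ?P = \<gamma> ^ (?d ^ n)" "lead_coeff ?Q = \<gamma> ^ (?d ^ n)"
    using degree_orbit_poly[of f a n] degree_orbit_poly[of f b n] assms by auto
  have N: "m * ?d ^ n \<ge> 1" using assms(2,5) by (simp add: Suc_le_eq)
  have eq: "orbit_poly f a (Suc n) - orbit_poly f b (Suc n) = pcompose f ?P - pcompose f ?Q" by simp
  have step: "degree (pcompose f ?P - pcompose f ?Q) = degree (?P - ?Q) + (?d - 1) * (m * ?d ^ n) \<and>
    lead_coeff (pcompose f ?P - pcompose f ?Q) =
      lead_coeff (?P - ?Q) * of_nat ?d * (\<gamma> ^ (?d ^ n)) ^ (?d - 1)"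
    using assms(1,2) P N Suc by (intro pcompose_diff) auto
  have pos: "?d ^ n \<ge> 1" using assms(2) by simp
  have e: "(?d ^ n - 1) + ?d ^ n * (?d - 1) = ?d ^ Suc n - 1"
    using pos assms(2) by (simp add: diff_mult_distrib2 mult.commute)
  have "(?d ^ n - 1) * m + (?d - 1) * (m * ?d ^ n) = ((?d ^ n - 1) + ?d ^ n * (?d - 1)) * m"
    by (simp add: algebra_simps)
  then have 1: "degree (orbit_poly f a (Suc n) - orbit_poly f b (Suc n)) = degree (a - b) + (?d ^ Suc n - 1) * m"
    unfolding eq using step Suc e by (metis add.assoc)
  have "\<gamma> ^ (?d ^ n - 1) * (\<gamma> ^ (?d ^ n)) ^ (?d - 1) = \<gamma> ^ (?d ^ Suc n - 1)"
    unfolding e[symmetric] by (simp only: power_add power_mult)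
  then have 2: "lead_coeff (orbit_poly f a (Suc n) - orbit_poly f b (Suc n)) =
      lead_coeff (a - b) * of_nat ?d ^ Suc n * \<gamma> ^ (?d ^ Suc n - 1)"
    unfolding eq conjunct2[OF step] conjunct1[OF conjunct2[OF Suc]] by (simp add: mult_ac)
  have "\<gamma> \<noteq> 0" "?d \<noteq> 0" "lead_coeff (a - b) \<noteq> 0"
    using assms by (auto simp del: coeff_diff)
  then have "lead_coeff (orbit_poly f a (Suc n) - orbit_poly f b (Suc n)) \<noteq> 0"
    unfolding 2 by (simp del: coeff_diff)
  then have "orbit_poly f a (Suc n) \<noteq> orbit_poly f b (Suc n)" by auto
  with 1 2 show ?case by blast
qed (use assms in simp)

section \<open>Determinants\<close>

text \<open>The matrix of coefficients is lower triangular, and evaluation is its product with the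
  Vandermonde matrix.\<close>

lemma det_poly_matrix:
  fixes p :: "nat \<Rightarrow> complex poly" and l :: "nat \<Rightarrow> complex"
  assumes "\<And>k. k < r \<Longrightarrow> degree (p k) \<le> k"
  shows "det (mat r r (\<lambda>(k, i). poly (p k) (l i))) =
    (\<Prod>k<r. coeff (p k) k) * det (mat r r (\<lambda>(k, i). l i ^ k))"
proof -
  define T where "T = mat r r (\<lambda>(k, j). coeff (p k) j)"
  define V where "V = mat r r (\<lambda>(k, i). l i ^ k)"
  have TV: "T \<in> carrier_mat r r" "V \<in> carrier_mat r r" by (simp_all add: T_def V_def)
  have "mat r r (\<lambda>(k, i). poly (p k) (l i)) = T * V"
  proof (rule eq_matI)
    fix k i assume ki: "k < dim_row (T * V)" "i < dim_col (T * V)"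
    then have ki: "k < r" "i < r" using TV by auto
    have "(T * V) $$ (k, i) = (\<Sum>j<r. coeff (p k) j * l i ^ j)"
      using ki by (simp add: T_def V_def scalar_prod_def lessThan_atLeast0)
    also have "\<dots> = (\<Sum>j\<le>degree (p k). coeff (p k) j * l i ^ j)"
      using assms[OF ki(1)] ki(1) by (intro sum.mono_neutral_right) (auto simp: coeff_eq_0)
    finally show "mat r r (\<lambda>(k, i). poly (p k) (l i)) $$ (k, i) = (T * V) $$ (k, i)"
      using ki by (simp add: poly_altdef)
  qed (simp_all add: T_def V_def)
  moreover have "det T = (\<Prod>k<r. coeff (p k) k)"
  proof -
    have "det T = prod_list (diag_mat T)"
      using coeff_eq_0[OF le_less_trans[OF assms]]
      by (intro det_lower_triangular[OF _ TV(1)]) (auto simp: T_def)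
    also have "diag_mat T = map (\<lambda>k. coeff (p k) k) [0..<r]" by (simp add: diag_mat_def T_def)
    also have "prod_list \<dots> = (\<Prod>k<r. coeff (p k) k)"
      using prod.distinct_set_conv_list[of "[0..<r]" "\<lambda>k. coeff (p k) k"]
      by (simp add: lessThan_atLeast0)
    finally show ?thesis .
  qed
  ultimately show ?thesis using det_mult[OF TV] by (simp add: V_def)
qed

text \<open>A kernel vector of the transpose is the coefficient vector of a nonzero polynomial of
  degree below \<open>r\<close> with \<open>r\<close> roots.\<close>

lemma det_vandermonde_nonzero:
  fixes l :: "nat \<Rightarrow> complex"
  assumes "inj_on l {..<r}"
  shows "det (mat r r (\<lambda>(k, i). l i ^ k)) \<noteq> 0"
proof
  define W where "W = mat r r (\<lambda>(i, k). l i ^ k)"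
  assume "det (mat r r (\<lambda>(k, i). l i ^ k)) = 0"
  moreover have "transpose_mat W = mat r r (\<lambda>(k, i). l i ^ k)" by (auto simp: W_def)
  moreover have W: "W \<in> carrier_mat r r" by (simp add: W_def)
  ultimately have "det W = 0" using det_transpose[OF W] by simp
  then obtain v where v: "v \<in> carrier_vec r" "v \<noteq> 0\<^sub>v r" "W *\<^sub>v v = 0\<^sub>v r"
    using det_0_iff_vec_prod_zero[OF W] by blast
  define p where "p = (\<Sum>k<r. monom (v $ k) k)"
  have cp: "coeff p j = (if j < r then v $ j else 0)" for j
    by (simp add: p_def coeff_sum if_distrib cong: if_cong)
  have root: "poly p (l i) = 0" if "i < r" for i
  proof -
    have "(W *\<^sub>v v) $ i = (\<Sum>k<r. l i ^ k * v $ k)"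
      using that v(1) by (auto simp: W_def scalar_prod_def lessThan_atLeast0)
    then show ?thesis using v(3) that by (simp add: p_def poly_sum poly_monom mult.commute)
  qed
  have "p \<noteq> 0"
  proof
    assume "p = 0"
    then have "v $ j = 0" if "j < r" for j using cp[of j] that by simp
    then have "v = 0\<^sub>v r" using v(1) by (intro eq_vecI) auto
    with v(2) show False by simp
  qed
  have "degree p < r"
  proof -
    have "coeff p (degree p) \<noteq> 0" using \<open>p \<noteq> 0\<close> by simp
    then show ?thesis using cp[of "degree p"] by (metis (full_types))
  qed
  moreover have "r = card (l ` {..<r})" using assms by (simp add: card_image)
  moreover have "card (l ` {..<r}) \<le> card {x. poly p x = 0}"
    using root poly_roots_finite[OF \<open>p \<noteq> 0\<close>] by (intro card_mono) auto
  moreover have "card {x. poly p x = 0} \<le> degree p" using \<open>p \<noteq> 0\<close> by (rule card_poly_roots_bound)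
  ultimately show False by simp
qed

text \<open>With \<open>fact r\<close> spread over the product, the \<open>k\<close>-th factor
  becomes \<open>Suc k * G * (1/2) ^ (k div D)\<close>, which tends to 0 and so is eventually at
  most 1/2.\<close>

lemma fact_times_prod_lt_1:
  fixes G :: real
  assumes "G > 0" "D \<ge> 1"
  shows "\<exists>r. fact r * (\<Prod>k<r. G * (1/2) ^ (k div D)) < 1"
proof -
  define x where "x = (\<lambda>k. real (Suc k) * (G * (1/2) ^ (k div D)))"
  have 1: "(\<lambda>j. real j * (1/2) ^ j) \<longlonglongrightarrow> 0" by (rule powser_times_n_limit_0) simp
  have 2: "(\<lambda>j. (1/2 :: real) ^ j) \<longlonglongrightarrow> 0" by (rule LIMSEQ_power_zero) simp
  have "(\<lambda>j. real D * G * (real j * (1/2) ^ j + (1/2) ^ j)) \<longlonglongrightarrow> real D * G * (0 + 0)"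
    by (rule tendsto_mult[OF tendsto_const tendsto_add[OF 1 2]])
  then have "eventually (\<lambda>j. real D * G * (real j * (1/2) ^ j + (1/2) ^ j) < 1/2) sequentially"
    by (rule order_tendstoD) simp
  then obtain K where K: "\<And>j. j \<ge> K \<Longrightarrow> real D * G * (real j * (1/2) ^ j + (1/2) ^ j) < 1/2"
    unfolding eventually_sequentially by blast
  have x_pos: "x k > 0" for k using assms by (simp add: x_def)
  have x_half: "x k \<le> 1/2" if "k \<ge> K * D" for k
  proof -
    define j where "j = k div D"
    have "j \<ge> K" unfolding j_def using that assms(2) by (simp add: less_eq_div_iff_mult_less_eq)
    have "k < D * Suc j" unfolding j_def using assms(2) by (simp add: dividend_less_times_div)
    then have "Suc k \<le> D * Suc j" by simp
    then have "real (Suc k) \<le> real D * real (Suc j)" by (metis of_nat_le_iff of_nat_mult)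
    then have "x k \<le> real D * real (Suc j) * (G * (1/2) ^ j)"
      unfolding x_def j_def[symmetric] using assms(1) by (intro mult_right_mono) auto
    also have "\<dots> = real D * G * (real j * (1/2) ^ j + (1/2) ^ j)" by (simp add: algebra_simps)
    also have "\<dots> < 1/2" by (rule K) fact
    finally show ?thesis by simp
  qed
  define M where "M = K * D"
  define B where "B = (\<Prod>k<M. x k)"
  have B: "B \<ge> 0" unfolding B_def using x_pos by (intro prod_nonneg) (auto intro: less_imp_le)
  have "(\<lambda>i. B * (1/2) ^ i) \<longlonglongrightarrow> B * 0" by (intro tendsto_mult LIMSEQ_power_zero tendsto_const) simp
  then have "eventually (\<lambda>i. B * (1/2) ^ i < 1) sequentially" by (rule order_tendstoD) simp
  then obtain i where i: "B * (1/2) ^ i < 1" unfolding eventually_sequentially by blast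
  have "(\<Prod>k<M + i. x k) \<le> B * (1/2) ^ i"
  proof (induction i)
    case 0
    show ?case by (simp add: B_def)
  next
    case (Suc i)
    have "(\<Prod>k<M + Suc i. x k) = (\<Prod>k<M + i. x k) * x (M + i)" by simp
    also have "\<dots> \<le> (B * (1/2) ^ i) * (1/2)"
      using Suc x_half[of "M + i"] x_pos[of "M + i"] B by (intro mult_mono) (auto simp: M_def)
    finally show ?case by simp
  qed
  moreover have "(\<Prod>k<r. x k) = fact r * (\<Prod>k<r. G * (1/2) ^ (k div D))" for r
    by (simp add: x_def prod.distrib fact_prod_Suc lessThan_atLeast0)
  ultimately show ?thesis using i by (metis le_less_trans)
qed

section \<open>Finiteness of simultaneously preperiodic parameters\<close>

text \<open>One denominator \<open>q\<close> and one bound \<open>T\<close> serve all coefficients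
  of the equations solved for \<open>x ^ degree a\<close> and \<open>z ^ degree f\<close>; the
  inverses of the leading coefficients normalize the determinant rows.\<close>

locale parameter_family = cost_ring +
  fixes f a b :: "complex poly" and q :: complex and T :: real
  assumes monic: "lead_coeff f = 1" and deg_f: "degree f \<ge> 2"
    and deg_a: "degree a \<ge> 2" and deg_b: "degree b = degree a"
    and lead_b: "lead_coeff b = lead_coeff a" and a_ne_b: "a \<noteq> b"
    and q_L: "q \<in> L" and q_nz: "q \<noteq> 0" and T_ge_1: "T \<ge> 1"
    and q_cost: "C q T"
    and lead_a_cost: "C (lead_coeff a) T"
    and inv_lead_a: "C (1 / lead_coeff a) T" "q * (1 / lead_coeff a) \<in> L"
    and inv_lead_diff: "C (1 / lead_coeff (a - b)) T"
    and a_coeffs: "i < degree a \<Longrightarrow> C (- (coeff a i / lead_coeff a)) T"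
      "i < degree a \<Longrightarrow> q * (- (coeff a i / lead_coeff a)) \<in> L"
    and f_coeffs: "i < degree f \<Longrightarrow> C (- coeff f i) T" "i < degree f \<Longrightarrow> q * (- coeff f i) \<in> L"
begin

abbreviation "d \<equiv> degree f"
abbreviation "m \<equiv> degree a"
abbreviation "\<gamma> \<equiv> lead_coeff a"
abbreviation "\<eta> \<equiv> lead_coeff (a - b)"

text \<open>The second factor exceeds the numbers of summands, \<open>m + 1\<close> and
  \<open>d + 2\<close>, in the two kinds of relations between generators.\<close>

definition R :: real where "R = T * (real m + real d + 3)"

definition bad :: "complex set" where
  "bad = {x. preperiodic (f + [:x:]) (poly a x) \<and> preperiodic (f + [:x:]) (poly b x)}"

text \<open>The degree of P_J; likewise \<open>D n\<close> is the degree of P_n - Q_n.\<close>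

definition N :: "nat \<Rightarrow> nat" where "N J = m * d ^ J"

definition D :: "nat \<Rightarrow> nat" where "D n = degree (a - b) + (d ^ n - 1) * m"

lemma R_ge_1: "R \<ge> 1"
proof -
  have "1 * 1 \<le> T * (real m + real d + 3)" using T_ge_1 by (intro mult_mono) auto
  then show ?thesis by (simp add: R_def)
qed

lemma gamma_nz: "\<gamma> \<noteq> 0" and eta_nz: "\<eta> \<noteq> 0"
  using deg_a a_ne_b by (auto simp del: coeff_diff)

lemma degree_diff: "degree (a - b) < m"
proof -
  have "degree (a - b) \<le> m" using degree_diff_le[of a m b] deg_b by simp
  moreover have "degree (a - b) \<noteq> m" using eta_nz lead_b deg_b by auto
  ultimately show ?thesis by simp
qed

text \<open>The gain: the leading coefficient of \<open>P\<^sub>n - Q\<^sub>n\<close> contains the factor \<open>d ^ n\<close>, whereas its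
  values at the points of \<open>bad\<close> have cost at most \<open>2 * R\<close>, uniformly in \<open>n\<close>.\<close>

definition cost :: "nat \<Rightarrow> nat \<Rightarrow> nat \<Rightarrow> real" where
  "cost n J k = T ^ (k div N J + k mod N J) * (T ^ (N J + D n + k div D n) * T ^ (k div D n) *
     ((1 / real d) ^ n) ^ (k div D n) * (R ^ (k mod D n) * (R + R) ^ (k div D n)))"

text \<open>Both exponents of \<open>\<gamma>\<close> are about \<open>k / m\<close>: the first
  exceeds the second by at most \<open>D n + k div D n\<close>, the second exceeds the first by at
  most \<open>N J\<close>. The bulk of the powers cancels before any cost is charged.\<close>

lemma power_quotient_cost:
  assumes "N J > 0" "D n > 0"
  shows "C (\<gamma> ^ (d ^ J * (k div N J)) / \<gamma> ^ ((d ^ n - 1) * (k div D n))) (T ^ (N J + D n + k div D n))"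
proof -
  define x where "x = d ^ J * (k div N J)"
  define y where "y = (d ^ n - 1) * (k div D n)"
  define t where "t = k div D n"
  have 1: "m * x + k mod N J = k"
    using div_mult_mod_eq[of k "N J"] by (simp add: x_def N_def algebra_simps)
  have 2: "m * y + degree (a - b) * t + k mod D n = k"
    using div_mult_mod_eq[of k "D n"] by (simp add: y_def t_def D_def algebra_simps)
  have m: "m \<ge> 1" using deg_a by simp
  have 3: "x \<le> y + (t + D n)"
  proof -
    have "degree (a - b) * t \<le> m * t" using degree_diff by (intro mult_le_mono) auto
    moreover have "k mod D n \<le> m * D n"
      using mult_le_mono[OF m, of "k mod D n" "D n"] assms(2) by (simp add: less_imp_le)
    ultimately have "m * x \<le> m * y + (m * t + m * D n)" using 1 2 by linarith
    then have "m * x \<le> m * (y + (t + D n))" by (simp only: distrib_left)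
    then show ?thesis using m by simp
  qed
  have 4: "y \<le> x + N J"
  proof -
    have "k mod N J \<le> m * N J"
      using mult_le_mono[OF m, of "k mod N J" "N J"] assms(1) by (simp add: less_imp_le)
    then have "m * y \<le> m * x + m * N J" using 1 2 by linarith
    then have "m * y \<le> m * (x + N J)" by (simp only: distrib_left)
    then show ?thesis using m by simp
  qed
  show ?thesis
  proof (cases "y \<le> x")
    case True
    then have "\<gamma> ^ x / \<gamma> ^ y = \<gamma> ^ (x - y)" using gamma_nz by (simp add: power_diff)
    then have "C (\<gamma> ^ x / \<gamma> ^ y) (T ^ (x - y))" using C_power[OF lead_a_cost] by simp
    moreover have "T ^ (x - y) \<le> T ^ (N J + D n + t)" using T_ge_1 3 by (intro power_increasing) auto
    ultimately show ?thesis unfolding x_def y_def t_def by (rule C_mono)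
  next
    case False
    then have "\<gamma> ^ x / \<gamma> ^ y = (1 / \<gamma>) ^ (y - x)" using gamma_nz
      by (simp add: power_diff power_one_over)
    then have "C (\<gamma> ^ x / \<gamma> ^ y) (T ^ (y - x))" using C_power[OF inv_lead_a(1)] by simp
    moreover have "T ^ (y - x) \<le> T ^ (N J + D n + t)" using T_ge_1 4 by (intro power_increasing) auto
    ultimately show ?thesis unfolding x_def y_def t_def by (rule C_mono)
  qed
qed

text \<open>Both \<open>W\<close> and \<open>W'\<close> below are multiples of the same Vandermonde determinant. The first one,
  built from \<open>P\<^sub>J\<close>, is integral up to few factors \<open>q\<close>; the second one, built from
  \<open>P\<^sub>n - Q\<^sub>n\<close>, has small cost.\<close>

lemma determinant_bound:
  assumes \<Lambda>: "finite \<Lambda>" "\<Lambda> \<subseteq> bad" and D_pos: "D n > 0"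
  shows "1 \<le> fact (card \<Lambda>) * (\<Prod>k<card \<Lambda>. cost n J k)"
proof -
  define P where "P = orbit_poly f a"
  define Q where "Q = orbit_poly f b"
  define OP where "OP = (\<Union>x\<in>\<Lambda>. range (\<lambda>n. poly (P n) x))"
  define OQ where "OQ = (\<Union>x\<in>\<Lambda>. range (\<lambda>n. poly (Q n) x))"
  \<comment> \<open>Whole orbits, yet finite by preperiodicity. Every value of an iterate is thus a
    generator, of cost \<open>R\<close> whatever its index.\<close>
  define Y where "Y = \<Lambda> \<union> OP \<union> OQ"
  define dg where "dg = (\<lambda>y. if y \<in> \<Lambda> then m else d)"
  define r where "r = card \<Lambda>"
  have "finite OP" "finite OQ"
    using \<Lambda> finite_orbit_poly unfolding OP_def OQ_def P_def Q_def bad_def by auto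
  then have fin_Y: "finite Y" using \<Lambda>(1) by (simp add: Y_def)
  interpret ext: cost_ring_extension L C Y q R
    by unfold_locales (use fin_Y q_L q_nz R_ge_1 in auto)
  have T_nonneg: "0 \<le> T" using T_ge_1 by simp
  have q1: "q * 1 \<in> L" "q * (-1) \<in> L" using q_L L_uminus by auto
  have C1: "C 1 T" "C (-1) T" using C_mono[OF C_1 T_ge_1] C_uminus by auto
  have R_pow: "real c * T * R ^ (e - 1) \<le> R ^ e" if "real c \<le> real m + real d + 3" "e \<ge> 1" for c e
  proof -
    have "T * real c \<le> R" unfolding R_def using that(1) T_nonneg by (rule mult_left_mono)
    then have "real c * T \<le> R" by (simp add: mult.commute)
    then have "real c * T * R ^ (e - 1) \<le> R * R ^ (e - 1)" using R_ge_1 by (intro mult_right_mono) auto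
    then show ?thesis using that(2) by (simp flip: power_Suc)
  qed
  \<comment> \<open>The starting value \<open>poly a x\<close> is a generator too, and as a word of
    length 1 it is shorter than \<open>m\<close> because \<open>m \<ge> 2\<close>.\<close>
  have rel_\<Lambda>: "ext.comb (m - 1) m (x ^ m) (R ^ m)" if x: "x \<in> \<Lambda>" for x
  proof -
    have Y: "x \<in> Y" "poly a x \<in> Y"
      using x rangeI[of "\<lambda>n. poly (P n) x" 0] by (auto simp: Y_def OP_def P_def)
    have "poly a x = (\<Sum>i<m. coeff a i * x ^ i) + \<gamma> * x ^ m"
      unfolding poly_altdef by (simp flip: lessThan_Suc_atMost)
    then have "x ^ m = (1 / \<gamma>) * poly a x - (\<Sum>i<m. coeff a i * x ^ i) / \<gamma>"
      using gamma_nz by (simp add: field_simps)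
    also have "\<dots> = (1 / \<gamma>) * prod_list [poly a x] + (\<Sum>i<m. - (coeff a i / \<gamma>) * x ^ i)"
      by (simp add: sum_divide_distrib sum_negf)
    finally have eq: "x ^ m = (1 / \<gamma>) * prod_list [poly a x] + (\<Sum>i<m. - (coeff a i / \<gamma>) * x ^ i)" .
    have "ext.comb (m - 1) m (x ^ m) (T * R ^ (m - 1) + real m * T * R ^ (m - 1))"
      unfolding eq using deg_a Y
      by (intro ext.comb_add ext.comb_single ext.comb_poly a_coeffs inv_lead_a) auto
    moreover have "T * R ^ (m - 1) + real m * T * R ^ (m - 1) \<le> R ^ m"
      using R_pow[of "Suc m" m] deg_a by (simp add: algebra_simps)
    ultimately show ?thesis by (rule ext.comb_mono)
  qed
  \<comment> \<open>The successor of an orbit point is again a generator, and \<open>f\<close> is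
    monic, so the orbit equation can be solved for \<open>z ^ d\<close>.\<close>
  have rel_orbit: "ext.comb (d - 1) d (z ^ d) (R ^ d)"
    if z: "z \<in> Y" "poly f z + x \<in> Y" "x \<in> Y" for x z
  proof -
    have "poly f z = (\<Sum>i<d. coeff f i * z ^ i) + z ^ d"
      unfolding poly_altdef using monic by (simp flip: lessThan_Suc_atMost)
    then have eq: "z ^ d = 1 * prod_list [poly f z + x] + (-1) * prod_list [x] + (\<Sum>i<d. - coeff f i * z ^ i)"
      by (simp add: sum_negf)
    have "ext.comb (d - 1) d (z ^ d) (T * R ^ (d - 1) + T * R ^ (d - 1) + real d * T * R ^ (d - 1))"
      unfolding eq using deg_f z
      by (intro ext.comb_add ext.comb_single ext.comb_poly f_coeffs C1 q1) auto
    moreover have "T * R ^ (d - 1) + T * R ^ (d - 1) + real d * T * R ^ (d - 1) \<le> R ^ d"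
      using R_pow[of "d + 2" d] deg_f by (simp add: algebra_simps)
    ultimately show ?thesis by (rule ext.comb_mono)
  qed
  have rel: "ext.comb (dg y - 1) (dg y) (y ^ dg y) (R ^ dg y)" if y: "y \<in> Y" for y
  proof (cases "y \<in> \<Lambda>")
    case True
    then show ?thesis using rel_\<Lambda> by (simp add: dg_def)
  next
    case False
    with y consider x j where "x \<in> \<Lambda>" "y = poly (P j) x" | x j where "x \<in> \<Lambda>" "y = poly (Q j) x"
      unfolding Y_def OP_def OQ_def by blast
    then have "\<exists>x\<in>Y. poly f y + x \<in> Y"
    proof cases
      case 1
      then have "poly f y + x = poly (P (Suc j)) x" by (simp add: P_def poly_pcompose)
      then have "poly f y + x \<in> OP" using 1 unfolding OP_def by blast
      then show ?thesis using 1 by (auto simp: Y_def)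
    next
      case 2
      then have "poly f y + x = poly (Q (Suc j)) x" by (simp add: Q_def poly_pcompose)
      then have "poly f y + x \<in> OQ" using 2 unfolding OQ_def by blast
      then show ?thesis using 2 by (auto simp: Y_def)
    qed
    then show ?thesis using rel_orbit y False by (auto simp: dg_def)
  qed
  interpret ext: integral_extension L C Y q R dg
    by unfold_locales (use rel deg_a deg_f in \<open>auto simp: dg_def\<close>)
  interpret B: cost_ring ext.lat ext.rep by (rule ext.cost_ring_integral)
  obtain l where l: "inj_on l {..<r}" "l ` {..<r} = \<Lambda>"
    using ex_bij_betw_nat_finite[OF \<Lambda>(1)] by (auto simp: r_def bij_betw_def lessThan_atLeast0)
  have NJ_pos: "N J > 0" using deg_a deg_f by (simp add: N_def)
  define t where "t = (\<lambda>k. k div N J)"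
  define s where "s = (\<lambda>k. k mod N J)"
  define t' where "t' = (\<lambda>k. k div D n)"
  define s' where "s' = (\<lambda>k. k mod D n)"
  define PJ where "PJ = P J"
  define DP where "DP = P n - Q n"
  have PJ: "degree PJ = N J" "lead_coeff PJ = \<gamma> ^ (d ^ J)" "PJ \<noteq> 0"
    using degree_orbit_poly[OF monic deg_f, of a J] deg_a NJ_pos by (auto simp: PJ_def P_def N_def)
  have DP: "degree DP = D n" "lead_coeff DP = \<eta> * of_nat d ^ n * \<gamma> ^ (d ^ n - 1)" "DP \<noteq> 0"
    using degree_orbit_poly_diff[OF monic deg_f refl deg_b _ refl lead_b a_ne_b, of n] deg_a
    by (auto simp: DP_def P_def Q_def D_def)
  define M where "M = (\<lambda>k. monom 1 (s k) * PJ ^ t k)"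
  define M' where "M' = (\<lambda>k. monom 1 (s' k) * DP ^ t' k)"
  \<comment> \<open>One factor \<open>q\<close> for each of the \<open>t k + s k\<close> generators
    multiplied in row \<open>k\<close> of \<open>W\<close>.\<close>
  define u where "u = (\<lambda>k. q ^ (t k + s k))"
  \<comment> \<open>Turns the leading coefficient of \<open>M' k\<close> into that of
    \<open>M k\<close>, so that the determinants agree; the inverse of \<open>d ^ n\<close> carries
    the gain.\<close>
  define v where "v = (\<lambda>k. (\<gamma> ^ (d ^ J * t k) / \<gamma> ^ ((d ^ n - 1) * t' k)) * (1 / \<eta>) ^ t' k *
    ((1 / of_nat d) ^ n) ^ t' k)"
  have M: "degree (M k) = k" "coeff (M k) k = \<gamma> ^ (d ^ J * t k)" for k
  proof -
    show 1: "degree (M k) = k"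
      using PJ(1,3) by (simp add: M_def degree_mult_eq degree_power_eq degree_monom_eq monom_eq_0_iff s_def t_def)
    have "lead_coeff (M k) = \<gamma> ^ (d ^ J * t k)"
      by (simp only: M_def lead_coeff_mult lead_coeff_power PJ(2) lead_coeff_monom power_mult mult_1)
    then show "coeff (M k) k = \<gamma> ^ (d ^ J * t k)" by (simp only: 1)
  qed
  have M': "degree (M' k) = k" "coeff (M' k) k = (\<eta> * of_nat d ^ n * \<gamma> ^ (d ^ n - 1)) ^ t' k" for k
  proof -
    show 1: "degree (M' k) = k"
      using DP(1,3) by (simp add: M'_def degree_mult_eq degree_power_eq degree_monom_eq monom_eq_0_iff s'_def t'_def)
    have "lead_coeff (M' k) = (\<eta> * of_nat d ^ n * \<gamma> ^ (d ^ n - 1)) ^ t' k"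
      by (simp only: M'_def lead_coeff_mult lead_coeff_power DP(2) lead_coeff_monom mult_1)
    then show "coeff (M' k) k = (\<eta> * of_nat d ^ n * \<gamma> ^ (d ^ n - 1)) ^ t' k" by (simp only: 1)
  qed
  have vM': "v k * coeff (M' k) k = coeff (M k) k" for k
  proof -
    have "of_nat d \<noteq> (0 :: complex)" using deg_f by auto
    then show ?thesis unfolding M(2) M'(2) v_def using gamma_nz eta_nz
      by (simp add: power_mult_distrib power_mult power_divide del: coeff_diff)
  qed
  define W where "W = mat r r (\<lambda>(k, i). poly (Polynomial.smult (u k) (M k)) (l i))"
  define W' where "W' = mat r r (\<lambda>(k, i). poly (Polynomial.smult (u k * v k) (M' k)) (l i))"
  have detW: "det W = (\<Prod>k<r. u k * coeff (M k) k) * det (mat r r (\<lambda>(k, i). l i ^ k))"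
    unfolding W_def by (subst det_poly_matrix) (auto intro: order_trans[OF degree_smult_le] simp: M(1))
  have detW': "det W' = (\<Prod>k<r. u k * v k * coeff (M' k) k) * det (mat r r (\<lambda>(k, i). l i ^ k))"
    unfolding W'_def by (subst det_poly_matrix) (auto intro: order_trans[OF degree_smult_le] simp: M'(1))
  have eq: "det W = det W'" unfolding detW detW' by (simp add: mult.assoc vM')
  have nz: "det W \<noteq> 0"
    unfolding detW using det_vandermonde_nonzero[OF l(1)] q_nz gamma_nz by (simp add: u_def M(2))
  have lY: "l i \<in> Y" "poly (P j) (l i) \<in> Y" "poly (Q j) (l i) \<in> Y" if "i < r" for i j
  proof -
    have "l i \<in> \<Lambda>" using that l(2) by blast
    then show "l i \<in> Y" "poly (P j) (l i) \<in> Y" "poly (Q j) (l i) \<in> Y"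
      unfolding Y_def OP_def OQ_def by blast+
  qed
  have signof_cases: "signof p = (1 :: complex) \<or> signof p = (-1 :: complex)" for p :: "nat \<Rightarrow> nat"
    by (simp add: sign_def)
  have lat: "det W \<in> ext.lat"
  proof -
    have entry: "W $$ (k, i) \<in> ext.lat" if "k < r" "i < r" for k i
    proof -
      have "W $$ (k, i) = (q * l i) ^ s k * (q * poly PJ (l i)) ^ t k"
        using that by (simp add: W_def u_def M_def poly_monom power_mult_distrib power_add)
      moreover have "(q * l i) ^ s k * (q * poly PJ (l i)) ^ t k \<in> ext.lat"
        unfolding PJ_def using lY[OF that(2)] by (intro B.L_mult B.L_power ext.lat_gen_1)
      ultimately show ?thesis by simp
    qed
    have "signof p * (\<Prod>i = 0..<r. W $$ (i, p i)) \<in> ext.lat" if "p permutes {0..<r}" for p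
    proof (rule B.L_mult)
      show "signof p \<in> ext.lat" using signof_cases[of p] B.one_L B.minus_one by metis
      show "(\<Prod>i = 0..<r. W $$ (i, p i)) \<in> ext.lat"
        using entry permutes_in_image[OF that] by (intro B.L_prod) auto
    qed
    then show ?thesis
      by (subst det_def'[of _ r]) (auto simp: W_def intro!: B.L_sum)
  qed
  have rep: "ext.rep (det W') (fact r * (\<Prod>k<r. cost n J k))"
  proof -
    have entry: "ext.rep (W' $$ (k, i)) (cost n J k)" if "k < r" "i < r" for k i
    proof -
      have cu: "C (u k) (T ^ (t k + s k))" unfolding u_def by (intro C_power q_cost)
      have cv: "C (v k) (T ^ (N J + D n + t' k) * T ^ t' k * ((1 / real d) ^ n) ^ t' k)"
        unfolding v_def t_def t'_def
        by (intro C_mult C_power C_inverse_nat inv_lead_diff power_quotient_cost NJ_pos D_pos)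
      have "ext.rep (poly DP (l i)) (R + R)"
        unfolding DP_def poly_diff using lY[OF that(2)] by (intro B.C_diff ext.rep_gen_1)
      then have cM: "ext.rep (l i ^ s' k * poly DP (l i) ^ t' k) (R ^ s' k * (R + R) ^ t' k)"
        using lY[OF that(2)] by (intro B.C_mult B.C_power ext.rep_gen_1)
      have "ext.rep (u k * (v k * (l i ^ s' k * poly DP (l i) ^ t' k)))
          (T ^ (t k + s k) * ((T ^ (N J + D n + t' k) * T ^ t' k * ((1 / real d) ^ n) ^ t' k) *
           (R ^ s' k * (R + R) ^ t' k)))"
        by (rule B.C_mult[OF ext.base[OF cu] B.C_mult[OF ext.base[OF cv] cM]])
      then show ?thesis
        using that by (simp add: W'_def M'_def poly_monom cost_def t_def s_def t'_def s'_def mult.assoc)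
    qed
    \<comment> \<open>In the Leibniz formula each permutation uses every row once, and the bound on
      an entry depends only on its row.\<close>
    have "ext.rep (signof p * (\<Prod>i = 0..<r. W' $$ (i, p i))) (\<Prod>k<r. cost n J k)"
      if "p permutes {0..<r}" for p
    proof -
      have "ext.rep (\<Prod>i = 0..<r. W' $$ (i, p i)) (\<Prod>k = 0..<r. cost n J k)"
        using entry permutes_in_image[OF that] by (intro B.C_prod) auto
      then show ?thesis
        using signof_cases[of p] B.C_uminus by (auto simp: lessThan_atLeast0)
    qed
    then have "ext.rep (\<Sum>p | p permutes {0..<r}. signof p * (\<Prod>i = 0..<r. W' $$ (i, p i)))
        (\<Sum>p | p permutes {0..<r}. (\<Prod>k<r. cost n J k))"
      by (intro B.C_sum finite_permutations) auto
    moreover have "card {p. p permutes {0..<r}} = fact r"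
      by (rule card_permutations) auto
    ultimately show ?thesis by (subst det_def'[of _ r]) (auto simp: W'_def)
  qed
  show ?thesis using B.power_gap[OF lat nz rep[folded eq]] unfolding r_def .
qed

text \<open>Order of choice: \<open>n\<close> makes each power of P_n - Q_n contribute at most 1/4,
  then \<open>J\<close> limits the denominators to a factor 2 per such power. The remaining halves
  have an exponent quadratic in \<open>r\<close>, which beats both \<open>fact r\<close> and
  \<open>G ^ r\<close>.\<close>

lemma exists_small_cost:
  "\<exists>n J r. D n > 0 \<and> fact r * (\<Prod>k<r. cost n J k) < 1"
proof -
  have "(\<lambda>n. (1 / real d) ^ n) \<longlonglongrightarrow> 0" using deg_f by (intro LIMSEQ_power_zero) simp
  moreover have K: "0 < 1 / (4 * (T * T * (R + R)))" using T_ge_1 R_ge_1 by simp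
  ultimately have "eventually (\<lambda>n. (1 / real d) ^ n < 1 / (4 * (T * T * (R + R))) \<and> n \<ge> 1) sequentially"
    using order_tendstoD(2) eventually_ge_at_top by (intro eventually_conj) blast+
  then obtain n where n: "(1 / real d) ^ n < 1 / (4 * (T * T * (R + R)))" "n \<ge> 1"
    unfolding eventually_sequentially by blast
  have small: "T * T * (1 / real d) ^ n * (R + R) \<le> 1 / 4"
    using n(1) K T_ge_1 R_ge_1 by (simp add: field_simps)
  have "d ^ n \<ge> 2" using deg_f n(2) self_le_power[of d n] by simp
  then have D_pos: "D n > 0" using deg_a by (simp add: D_def)
  obtain h where h: "T \<le> 2 ^ h" using real_arch_pow[of 2 T] by (auto intro: less_imp_le)
  \<comment> \<open>\<open>J\<close> is so large that the integrality factors \<open>T ^ (k div N J)\<close> do not eat up the gain.\<close>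
  define J where "J = h * D n"
  have "J \<le> d ^ J" using deg_f by (meson less_exp less_imp_le order_trans power_mono zero_le)
  also have "\<dots> \<le> N J" using deg_a by (simp add: N_def)
  finally have J: "h * D n \<le> N J" by (simp add: J_def)
  have NJ_pos: "N J > 0" using deg_a deg_f by (simp add: N_def)
  \<comment> \<open>Collects the factors bounded independently of \<open>k\<close>; the remainders
    are estimated by the moduli \<open>N J\<close> and \<open>D n\<close>.\<close>
  define G where "G = T ^ N J * T ^ (N J + D n) * R ^ D n"
  have G: "G > 0" using T_ge_1 R_ge_1 by (simp add: G_def)
  have bound: "cost n J k \<le> G * (1/2) ^ (k div D n)" for k
  proof -
    define t where "t = k div N J"
    define t' where "t' = k div D n"
    have "h * D n * t \<le> N J * t" using J by (rule mult_le_mono1)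
    also have "\<dots> \<le> k" by (simp add: t_def)
    finally have "h * t \<le> t'"
      unfolding t'_def using D_pos by (simp add: less_eq_div_iff_mult_less_eq mult_ac)
    then have "(2 :: real) ^ (h * t) \<le> 2 ^ t'" by (intro power_increasing) auto
    moreover have "T ^ t \<le> (2 ^ h) ^ t" using h T_ge_1 by (intro power_mono) auto
    ultimately have 1: "T ^ t \<le> 2 ^ t'" by (simp add: power_mult)
    have 2: "T ^ (k mod N J) \<le> T ^ N J" "R ^ (k mod D n) \<le> R ^ D n"
      using T_ge_1 R_ge_1 NJ_pos D_pos
      by (auto intro!: power_increasing mod_less_divisor[THEN less_imp_le])
    have "cost n J k = (T ^ (k mod N J) * T ^ (N J + D n) * R ^ (k mod D n)) *
        (T ^ t * (T * T * (1 / real d) ^ n * (R + R)) ^ t')"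
    proof -
      have "T ^ (t + s) * (T ^ (w + t') * T ^ t' * \<delta> ^ t' * (x * S ^ t')) =
          (T ^ s * T ^ w * x) * (T ^ t * (T * T * \<delta> * S) ^ t')" for s w x and \<delta> S :: real
        by (simp add: power_add power_mult_distrib mult_ac)
      then show ?thesis unfolding cost_def t_def[symmetric] t'_def[symmetric] .
    qed
    also have "\<dots> \<le> G * (2 ^ t' * (1/4) ^ t')"
      unfolding G_def using 1 2 small T_ge_1 R_ge_1
      by (intro mult_mono power_mono) (auto intro!: mult_nonneg_nonneg)
    also have "(2 :: real) ^ t' * (1/4) ^ t' = (1/2) ^ t'"
      by (simp add: power_mult_distrib[symmetric])
    finally show ?thesis unfolding t'_def .
  qed
  obtain r where r: "fact r * (\<Prod>k<r. G * (1/2) ^ (k div D n)) < 1"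
    using fact_times_prod_lt_1[OF G, of "D n"] D_pos by auto
  have nonneg: "cost n J k \<ge> 0" for k
    unfolding cost_def using T_ge_1 R_ge_1 by (intro mult_nonneg_nonneg zero_le_power) auto
  have "fact r * (\<Prod>k<r. cost n J k) \<le> fact r * (\<Prod>k<r. G * (1/2) ^ (k div D n))"
    using bound nonneg by (intro mult_left_mono prod_mono) auto
  with r D_pos show ?thesis by (meson le_less_trans)
qed

theorem finite_bad: "finite bad"
proof (rule ccontr)
  assume "infinite bad"
  obtain n J r where nJ: "D n > 0" "fact r * (\<Prod>k<r. cost n J k) < 1"
    using exists_small_cost by blast
  obtain \<Lambda> where "finite \<Lambda>" "card \<Lambda> = r" "\<Lambda> \<subseteq> bad"
    using infinite_arbitrarily_large[OF \<open>infinite bad\<close>] by metis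
  then show False using determinant_bound[of \<Lambda> n J] nJ by simp
qed

end

theorem finite_simultaneously_preperiodic:
  fixes f a b :: "complex poly"
  assumes "lead_coeff f = 1" "degree f \<ge> 2" "degree a \<ge> 2" "degree b = degree a"
    "lead_coeff b = lead_coeff a" "a \<noteq> b"
  shows "finite {x. preperiodic (f + [:x:]) (poly a x) \<and> preperiodic (f + [:x:]) (poly b x)}"
proof -
  define X where "X = {1 / lead_coeff a, lead_coeff a, 1 / lead_coeff (a - b)}
    \<union> (\<lambda>i. - (coeff a i / lead_coeff a)) ` {..<degree a} \<union> (\<lambda>i. - coeff f i) ` {..<degree f}"
  have "finite X" unfolding X_def by simp
  then obtain xs where "set xs = X" using finite_list by blast
  then obtain L C where LC: "cost_ring L C" "\<forall>x\<in>X. \<exists>u. C x u" using cost_ring_exists by metis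
  interpret cost_ring L C by fact
  have X: "finite X" "X \<subseteq> A" using \<open>finite X\<close> LC(2) by (auto simp: A_def)
  obtain q where q: "q \<in> L" "q \<noteq> 0" "\<And>x. x \<in> X \<Longrightarrow> q * x \<in> L" using common_clear[OF X] by blast
  have "finite (insert q (X))" "insert q (X) \<subseteq> A" using X L_A[OF q(1)] by auto
  then obtain T where T: "T \<ge> 1" "\<And>x. x \<in> insert q (X) \<Longrightarrow> C x T" using common_cost by blast
  have mem: "1 / lead_coeff a \<in> X" "lead_coeff a \<in> X" "1 / lead_coeff (a - b) \<in> X"
    "\<And>i. i < degree a \<Longrightarrow> - (coeff a i / lead_coeff a) \<in> X"
    "\<And>i. i < degree f \<Longrightarrow> - coeff f i \<in> X"
    unfolding X_def by blast+
  interpret parameter_family L C f a b q T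
    by unfold_locales (fact assms q(1,2) T(1) mem[THEN q(3)] mem[THEN insertI2, THEN T(2)] T(2)[OF insertI1])+
  show ?thesis using finite_bad unfolding bad_def .
qed

section \<open>Reduction to a monic polynomial and starting points of degree at least 2\<close>

lemma preperiodic_image:
  assumes "preperiodic h z"
  shows "preperiodic h (poly h z)"
proof -
  obtain i j where "i \<noteq> j" "(poly h ^^ i) z = (poly h ^^ j) z"
    using assms unfolding preperiodic_def by blast
  then have "(poly h ^^ i) (poly h z) = (poly h ^^ j) (poly h z)" by (simp add: funpow_swap1[symmetric])
  with \<open>i \<noteq> j\<close> show ?thesis unfolding preperiodic_def by blast
qed

lemma preperiodic_conjugate:
  assumes "\<And>z. poly h (\<alpha> * z) = \<alpha> * poly h' z" "\<alpha> \<noteq> 0" "preperiodic h (\<alpha> * z)"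
  shows "preperiodic h' z"
proof -
  have "(poly h ^^ n) (\<alpha> * z) = \<alpha> * (poly h' ^^ n) z" for n
    by (induction n) (simp_all add: assms(1))
  then show ?thesis using assms(2,3) unfolding preperiodic_def by simp
qed

text \<open>A polynomial with period \<open>c\<close> takes the value at 0 at all the points
  \<open>of_nat n * c\<close>, which are infinitely many.\<close>

lemma pcompose_shift_ne:
  fixes G :: "complex poly"
  assumes "degree G \<ge> 1" "c \<noteq> 0"
  shows "pcompose G [:c, 1:] \<noteq> G"
proof
  assume eq: "pcompose G [:c, 1:] = G"
  have "poly G (of_nat n * c) = poly G 0" for n
  proof (induction n)
    case (Suc n)
    have "poly G (of_nat (Suc n) * c) = poly (pcompose G [:c, 1:]) (of_nat n * c)"
      by (simp add: poly_pcompose algebra_simps)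
    with Suc show ?case by (simp only: eq)
  qed simp
  then have "range (\<lambda>n. of_nat n * c) \<subseteq> {x. poly (G - [:poly G 0:]) x = 0}" by auto
  moreover have "infinite (range (\<lambda>n. of_nat n * c))"
    using assms(2) by (intro range_inj_infinite) (auto simp: inj_on_def)
  moreover have "G - [:poly G 0:] \<noteq> 0" using assms(1) by (metis degree_pCons_0 eq_iff_diff_eq_0 not_one_le_zero)
  ultimately show False using poly_roots_finite finite_subset by blast
qed

theorem corollary1p13:
  fixes f g :: "complex poly" and c :: complex
  assumes "degree f \<ge> 2"
    and "degree g \<ge> 1"
    and "c \<noteq> 0"
  shows "finite {\<mu> :: complex. preperiodic (f + [:\<mu>:]) (poly g \<mu>)
                             \<and> preperiodic (f + [:\<mu>:]) (poly g (\<mu> + c))}"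
proof -
  define d where "d = degree f"
  have lf: "lead_coeff f \<noteq> 0" using assms(1) by auto
  define w where "w = 1 / lead_coeff f"
  \<comment> \<open>A root of order \<open>d - 1\<close> of \<open>1 / lead_coeff f\<close>:
    conjugation by \<open>z \<mapsto> \<alpha> * z\<close> then makes \<open>f\<close> monic, and it
    scales parameter and shift by \<open>1 / \<alpha>\<close>.\<close>
  define \<alpha> where "\<alpha> = rcis (root (d - 1) (cmod w)) (Arg w / real (d - 1))"
  have \<alpha>: "\<alpha> ^ (d - 1) = 1 / lead_coeff f"
    using assms(1) rcis_cmod_Arg[of w] unfolding \<alpha>_def DeMoivre2
    by (simp add: d_def w_def real_root_pow_pos2)
  have \<alpha>_nz: "\<alpha> \<noteq> 0" using \<alpha> lf assms(1) by (auto simp: d_def power_0_left split: if_splits)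
  define conj where "conj = (\<lambda>p. Polynomial.smult (1 / \<alpha>) (pcompose p [:0, \<alpha>:]))"
  have poly_conj: "\<alpha> * poly (conj p) z = poly p (\<alpha> * z)" for p z
    using \<alpha>_nz by (simp add: conj_def poly_pcompose mult.commute)
  have deg_conj: "degree (conj p) = degree p" for p
    using \<alpha>_nz by (simp add: conj_def degree_pcompose)
  define f' where "f' = conj f"
  define g' where "g' = conj g"
  define c' where "c' = c / \<alpha>"
  have monic: "lead_coeff f' = 1"
  proof -
    have "lead_coeff f' = 1 / \<alpha> * (lead_coeff f * \<alpha> ^ d)"
      unfolding f'_def conj_def lead_coeff_smult using \<alpha>_nz
      by (subst lead_coeff_comp) (auto simp: d_def)
    also have "\<alpha> ^ d = \<alpha> * \<alpha> ^ (d - 1)" using assms(1) by (simp add: d_def flip: power_Suc)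
    finally show ?thesis using \<alpha> \<alpha>_nz lf by simp
  qed
  \<comment> \<open>The starting points are moved one step along their orbits, which keeps them
    preperiodic and raises the degree to at least 2 even if \<open>g\<close> is linear.\<close>
  define G where "G = pcompose f' g'"
  define G' where "G' = pcompose G [:c', 1:]"
  have deg_G: "degree G \<ge> 2"
    using mult_le_mono[OF assms(1,2)] by (simp add: G_def f'_def g'_def deg_conj degree_pcompose)
  have deg_G': "degree G' = degree G" "lead_coeff G' = lead_coeff G"
    unfolding G'_def by (simp add: degree_pcompose) (subst lead_coeff_comp, auto)
  \<comment> \<open>Both points are iterated with the same parameter \<open>x\<close>, so
    \<open>b\<close> is not the shift of \<open>a\<close>: the term \<open>x\<close> is added after
    shifting. It cancels in \<open>a - b\<close>, and degree at least 2 keeps it away from the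
    leading terms.\<close>
  define a where "a = G + [:0, 1:]"
  define b where "b = G' + [:0, 1:]"
  have lt: "degree [:0, 1 :: complex:] < degree G" "degree [:0, 1 :: complex:] < degree G'"
    using deg_G deg_G' by auto
  have a: "degree a = degree G" "lead_coeff a = lead_coeff G"
    using degree_add_eq_left[OF lt(1)] lead_coeff_add_le[OF lt(1)] by (simp_all add: a_def add.commute)
  have b: "degree b = degree G" "lead_coeff b = lead_coeff G"
    using degree_add_eq_left[OF lt(2)] lead_coeff_add_le[OF lt(2)] deg_G' by (simp_all add: b_def add.commute)
  have "c' \<noteq> 0" using assms(3) \<alpha>_nz by (simp add: c'_def)
  then have "a \<noteq> b" using pcompose_shift_ne[of G c'] deg_G by (auto simp: a_def b_def G'_def)
  then have fin: "finite {x. preperiodic (f' + [:x:]) (poly a x) \<and> preperiodic (f' + [:x:]) (poly b x)}"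
    using monic assms(1) deg_G a b
    by (intro finite_simultaneously_preperiodic) (auto simp: f'_def deg_conj)
  have pre: "preperiodic (f' + [:x:]) (poly (f' + [:x:]) z)" if "preperiodic (f + [:\<alpha> * x:]) (\<alpha> * z)" for x z
  proof (rule preperiodic_image, rule preperiodic_conjugate[OF _ \<alpha>_nz that])
    show "poly (f + [:\<alpha> * x:]) (\<alpha> * w) = \<alpha> * poly (f' + [:x:]) w" for w
      by (simp add: f'_def distrib_left poly_conj)
  qed
  have "{\<mu>. preperiodic (f + [:\<mu>:]) (poly g \<mu>) \<and> preperiodic (f + [:\<mu>:]) (poly g (\<mu> + c))} \<subseteq>
    (\<lambda>x. \<alpha> * x) ` {x. preperiodic (f' + [:x:]) (poly a x) \<and> preperiodic (f' + [:x:]) (poly b x)}"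
  proof
    fix \<mu> assume \<mu>: "\<mu> \<in> {\<mu>. preperiodic (f + [:\<mu>:]) (poly g \<mu>) \<and> preperiodic (f + [:\<mu>:]) (poly g (\<mu> + c))}"
    define x where "x = \<mu> / \<alpha>"
    have x: "\<mu> = \<alpha> * x" "\<mu> + c = \<alpha> * (x + c')" using \<alpha>_nz by (simp_all add: x_def c'_def field_simps)
    have "poly a x = poly (f' + [:x:]) (poly g' x)" "poly b x = poly (f' + [:x:]) (poly g' (x + c'))"
      by (simp_all add: a_def b_def G_def G'_def poly_pcompose add.commute)
    moreover have "preperiodic (f + [:\<alpha> * x:]) (\<alpha> * poly g' x)"
      "preperiodic (f + [:\<alpha> * x:]) (\<alpha> * poly g' (x + c'))"
      using \<mu> unfolding g'_def poly_conj x(2)[symmetric] x(1)[symmetric] by auto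
    ultimately have "x \<in> {x. preperiodic (f' + [:x:]) (poly a x) \<and> preperiodic (f' + [:x:]) (poly b x)}"
      using pre by simp
    with x(1) show "\<mu> \<in> (\<lambda>x. \<alpha> * x) ` {x. preperiodic (f' + [:x:]) (poly a x) \<and> preperiodic (f' + [:x:]) (poly b x)}"
      by blast
  qed
  then show ?thesis using finite_subset finite_imageI[OF fin] by blast
qed

end
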